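(* Let $\mathcal{G}=(\mathsf{B},A,\psi)$ be a quantum graph with $\mathsf{B}=\bigoplus_{a=1}^{d}M_{n_a}$ and $\psi=\bigoplus_{a=1}^d\operatorname{Tr}(\rho_a\,\cdot)$ a $\delta$-form with each $\rho_a$ positive, invertible and diagonal, and let $E_{\mathcal{G}}$ be its quantum edge correspondence. For each pair $(a,b)\in\{1,\dots,d\}^2$ let $A_{ba}:M_{n_a}\to M_{n_b}$ be the restriction of $A$ to $M_{n_a}$ followed by the projection onto $M_{n_b}$, and let $(V_{ba}^r)_r$ be a finite family of $n_b\times n_a$ matrices (Kraus operators of $A_{ba}$) such that $$A_{ba}(x)=\sum_r V_{ba}^r\,x\,(V_{ba}^r)^*\quad (x\in M_{n_a}),\qquad \operatorname{Tr}\big(\rho_a^{-1}(V_{ba}^r)^*V_{ba}^q\big)=\delta^2\delta_{rq}\ \text{ for all } r,q.$$ For $1\le i\le n_a$ define $$\phi_{ab}^{ir}:=\frac{1}{\delta}\sum_{k=1}^{n_a}e_{ik}^a\rho_a^{-1}\otimes V_{ba}^r e_{k1}^{ab}\in M_{n_a}\otimes M_{n_b}\subseteq\mathsf{B}\otimes\mathsf{B}.$$ Then the family $(\phi_{ab}^{ir})_{a,b,i,r}$ is an orthonormal basis of $E_{\mathcal{G}}$.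
   Context: Quantum graphs. $\mathsf{B}=\bigoplus_{a=1}^d M_{n_a}$ is a finite-dimensional $C^*$-algebra with a faithful state $\psi=\bigoplus_{a=1}^d\operatorname{Tr}(\rho_a\,\cdot)$, where $\operatorname{Tr}$ is the non-normalized trace, each $\rho_a\in M_{n_a}$ is positive, invertible and (by convention) diagonal, and $\sum_a\operatorname{Tr}(\rho_a)=1$. $L^2(\mathsf{B})$ is $\mathsf{B}$ with inner product $\langle x,y\rangle_\psi=\psi(x^*y)$, $m:L^2(\mathsf{B})\otimes L^2(\mathsf{B})\to L^2(\mathsf{B})$ is the multiplication map and $m^*$ its Hilbert space adjoint. For $\delta>0$, $\psi$ is a $\delta$-form if $mm^*=\delta^2\mathrm{id}$ (equivalently $\operatorname{Tr}(\rho_a^{-1})=\delta^2$ for all $a$). A quantum graph is a triple $(\mathsf{B},A,\psi)$ with $\psi$ a $\delta$-form and $A:\mathsf{B}\to\mathsf{B}$ linear, $*$-preserving (equivalently, completely positive) and satisfying $m(A\otimes A)m^*=\delta^2A$. Quantum edge correspondence. $\mathsf{B}\otimes_\psi\mathsf{B}$ is the $C^*$-correspondence over $\mathsf{B}$ equal to $\mathsf{B}\otimes\mathsf{B}$ as a bimodule (left multiplication on the first leg, right multiplication on the second), with $\mathsf{B}$-valued inner product $\langle x\otimes y,z\otimes w\rangle=\psi(x^*z)\,y^*w$. The quantum edge indicator is $\varepsilon_{\mathcal{G}}=\frac{1}{\delta^2}(\mathrm{id}\otimes A)m^*(1)$ and the quantum edge correspondence is $E_{\mathcal{G}}=\operatorname{span}\{x\varepsilon_{\mathcal{G}}y: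 x,y\in\mathsf{B}\}$. Notation. $e_{ij}^a$ are the matrix units of $M_{n_a}$, and $e_{k\ell}^{ab}$ ($1\le k\le n_a$, $1\le\ell\le n_b$) are the matrix units of the $n_a\times n_b$ matrices. Orthonormal basis (in the "quasi" sense for Hilbert modules): a family of elements of a right Hilbert $\mathsf{B}$-module such that distinct members have $\mathsf{B}$-valued inner product $0$, the inner product of each member with itself is a projection in $\mathsf{B}$, and the family spans the module as a right $\mathsf{B}$-module. *)

theory Defs
  imports
    "HOL-Library.Function_Algebras"
    "HOL-Library.FuncSet"
    "Jordan_Normal_Form.Schur_Decomposition"
    "Jordan_Normal_Form.Gauss_Jordan_Elimination"
begin

section \<open>Matrices\<close>

definition mat_trace :: "complex mat \<Rightarrow> complex" where
  "mat_trace M = (\<Sum>i<dim_row M. M $$ (i, i))"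

definition mat_unit :: "nat \<Rightarrow> nat \<Rightarrow> nat \<Rightarrow> nat \<Rightarrow> complex mat" where
  "mat_unit nr nc i j = mat nr nc (\<lambda>(k, l). if k = i \<and> l = j then 1 else 0)"

definition mat_sum :: "nat \<Rightarrow> nat \<Rightarrow> 's set \<Rightarrow> ('s \<Rightarrow> complex mat) \<Rightarrow> complex mat" where
  "mat_sum nr nc S M = mat nr nc (\<lambda>ij. \<Sum>s\<in>S. M s $$ ij)"

text \<open>The order on \<^typ>\<open>complex\<close> is the one of \<^theory>\<open>HOL-Library.Complex_Order\<close>: \<open>0 \<le> z\<close> means that
  \<open>z\<close> is real and nonnegative.\<close>

definition pos_mat :: "nat \<Rightarrow> complex mat \<Rightarrow> bool" where
  "pos_mat k M \<longleftrightarrow> M \<in> carrier_mat k k \<and> (\<forall>v\<in>carrier_vec k. 0 \<le> (M *\<^sub>v v) \<bullet>c v)"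

text \<open>Only used for invertible matrices.\<close>

abbreviation mat_inv :: "complex mat \<Rightarrow> complex mat" where
  "mat_inv M \<equiv> the (mat_inverse M)"


section \<open>The algebra \<open>\<Oplus>\<^sub>a M\<^bsub>n a\<^esub>\<close>\<close>

text \<open>Blocks are numbered \<open>0, \<dots>, d - 1\<close> and matrix indices start at \<open>0\<close>. An element is the
  extensional family of its blocks.\<close>

type_synonym alg = "nat \<Rightarrow> complex mat"

definition alg_carrier :: "nat \<Rightarrow> (nat \<Rightarrow> nat) \<Rightarrow> alg set" where
  "alg_carrier d n = (\<Pi>\<^sub>E a\<in>{..<d}. carrier_mat (n a) (n a))"

definition alg_zero :: "nat \<Rightarrow> (nat \<Rightarrow> nat) \<Rightarrow> alg" where
  "alg_zero d n = (\<lambda>a\<in>{..<d}. 0\<^sub>m (n a) (n a))"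

definition alg_one :: "nat \<Rightarrow> (nat \<Rightarrow> nat) \<Rightarrow> alg" where
  "alg_one d n = (\<lambda>a\<in>{..<d}. 1\<^sub>m (n a))"

definition alg_add :: "nat \<Rightarrow> alg \<Rightarrow> alg \<Rightarrow> alg" where
  "alg_add d x y = (\<lambda>a\<in>{..<d}. x a + y a)"

definition alg_scale :: "nat \<Rightarrow> complex \<Rightarrow> alg \<Rightarrow> alg" where
  "alg_scale d c x = (\<lambda>a\<in>{..<d}. c \<cdot>\<^sub>m x a)"

definition alg_mult :: "nat \<Rightarrow> alg \<Rightarrow> alg \<Rightarrow> alg" where
  "alg_mult d x y = (\<lambda>a\<in>{..<d}. x a * y a)"

definition alg_star :: "nat \<Rightarrow> alg \<Rightarrow> alg" where
  "alg_star d x = (\<lambda>a\<in>{..<d}. mat_adjoint (x a))"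

definition alg_lincomb ::
  "nat \<Rightarrow> (nat \<Rightarrow> nat) \<Rightarrow> 's set \<Rightarrow> ('s \<Rightarrow> complex) \<Rightarrow> ('s \<Rightarrow> alg) \<Rightarrow> alg" where
  "alg_lincomb d n S c x = (\<lambda>a\<in>{..<d}. mat_sum (n a) (n a) S (\<lambda>s. c s \<cdot>\<^sub>m x s a))"

definition alg_embed :: "nat \<Rightarrow> (nat \<Rightarrow> nat) \<Rightarrow> nat \<Rightarrow> complex mat \<Rightarrow> alg" where
  "alg_embed d n a M = (\<lambda>c\<in>{..<d}. if c = a then M else 0\<^sub>m (n c) (n c))"

definition alg_projection :: "nat \<Rightarrow> (nat \<Rightarrow> nat) \<Rightarrow> alg \<Rightarrow> bool" where
  "alg_projection d n p \<longleftrightarrow> p \<in> alg_carrier d n \<and> alg_mult d p p = p \<and> alg_star d p = p"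

text \<open>The triple \<open>(a, i, j)\<close> stands for the matrix unit \<open>e\<^sub>i\<^sub>j\<close> of the block \<open>a\<close>.\<close>

type_synonym unit_index = "nat \<times> nat \<times> nat"

definition unit_indices :: "nat \<Rightarrow> (nat \<Rightarrow> nat) \<Rightarrow> unit_index set" where
  "unit_indices d n = (SIGMA a:{..<d}. {..<n a} \<times> {..<n a})"

definition alg_unit :: "nat \<Rightarrow> (nat \<Rightarrow> nat) \<Rightarrow> unit_index \<Rightarrow> alg" where
  "alg_unit d n = (\<lambda>(a, i, j). alg_embed d n a (mat_unit (n a) (n a) i j))"

definition alg_coord :: "alg \<Rightarrow> unit_index \<Rightarrow> complex" where
  "alg_coord x = (\<lambda>(a, i, j). x a $$ (i, j))"

definition state_density :: "nat \<Rightarrow> (nat \<Rightarrow> nat) \<Rightarrow> (nat \<Rightarrow> complex mat) \<Rightarrow> bool" where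
  "state_density d n \<rho> \<longleftrightarrow>
     (\<forall>a<d. pos_mat (n a) (\<rho> a) \<and> invertible_mat (\<rho> a)) \<and> (\<Sum>a<d. mat_trace (\<rho> a)) = 1"

definition alg_state :: "nat \<Rightarrow> (nat \<Rightarrow> complex mat) \<Rightarrow> alg \<Rightarrow> complex" where
  "alg_state d \<rho> x = (\<Sum>a<d. mat_trace (\<rho> a * x a))"

definition alg_inner :: "nat \<Rightarrow> (nat \<Rightarrow> complex mat) \<Rightarrow> alg \<Rightarrow> alg \<Rightarrow> complex" where
  "alg_inner d \<rho> x y = alg_state d \<rho> (alg_mult d (alg_star d x) y)"

definition alg_linear :: "nat \<Rightarrow> (nat \<Rightarrow> nat) \<Rightarrow> (alg \<Rightarrow> alg) \<Rightarrow> bool" where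
  "alg_linear d n A \<longleftrightarrow>
     (\<forall>x\<in>alg_carrier d n. A x \<in> alg_carrier d n) \<and>
     (\<forall>x\<in>alg_carrier d n. \<forall>y\<in>alg_carrier d n. A (alg_add d x y) = alg_add d (A x) (A y)) \<and>
     (\<forall>c. \<forall>x\<in>alg_carrier d n. A (alg_scale d c x) = alg_scale d c (A x))"

definition star_preserving :: "nat \<Rightarrow> (nat \<Rightarrow> nat) \<Rightarrow> (alg \<Rightarrow> alg) \<Rightarrow> bool" where
  "star_preserving d n A \<longleftrightarrow> (\<forall>x\<in>alg_carrier d n. A (alg_star d x) = alg_star d (A x))"

text \<open>The component \<open>M\<^bsub>n a\<^esub> \<rightarrow> M\<^bsub>n b\<^esub>\<close> of \<open>A\<close>.\<close>

definition block_map ::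
  "nat \<Rightarrow> (nat \<Rightarrow> nat) \<Rightarrow> (alg \<Rightarrow> alg) \<Rightarrow> nat \<Rightarrow> nat \<Rightarrow> complex mat \<Rightarrow> complex mat" where
  "block_map d n A b a x = A (alg_embed d n a x) b"


section \<open>The tensor square\<close>

text \<open>A tensor is given by its coefficients: \<open>T p q\<close> is the coefficient of \<open>e\<^sub>p \<otimes> e\<^sub>q\<close>, where \<open>e\<^sub>p\<close> and
  \<open>e\<^sub>q\<close> are the matrix units indexed by \<open>p\<close> and \<open>q\<close>. Linear and sesquilinear maps on tensors are
  defined by extension from the tensors \<open>e\<^sub>p \<otimes> e\<^sub>q\<close>.\<close>

type_synonym tensor = "unit_index \<Rightarrow> unit_index \<Rightarrow> complex"

definition tensor_carrier :: "nat \<Rightarrow> (nat \<Rightarrow> nat) \<Rightarrow> tensor set" where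
  "tensor_carrier d n = {T. \<forall>p q. p \<notin> unit_indices d n \<or> q \<notin> unit_indices d n \<longrightarrow> T p q = 0}"

definition tensor_scale :: "complex \<Rightarrow> tensor \<Rightarrow> tensor" where
  "tensor_scale c T = (\<lambda>p q. c * T p q)"

interpretation tensor: vector_space tensor_scale
  by unfold_locales (auto simp: tensor_scale_def fun_eq_iff algebra_simps)

definition tensor_prod :: "nat \<Rightarrow> (nat \<Rightarrow> nat) \<Rightarrow> alg \<Rightarrow> alg \<Rightarrow> tensor" where
  "tensor_prod d n x y = (\<lambda>p q. if p \<in> unit_indices d n \<and> q \<in> unit_indices d n
     then alg_coord x p * alg_coord y q else 0)"

definition tensor_map ::
  "nat \<Rightarrow> (nat \<Rightarrow> nat) \<Rightarrow> (alg \<Rightarrow> alg) \<Rightarrow> (alg \<Rightarrow> alg) \<Rightarrow> tensor \<Rightarrow> tensor" where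
  "tensor_map d n F G T = (\<Sum>(p, q)\<in>unit_indices d n \<times> unit_indices d n.
     tensor_scale (T p q) (tensor_prod d n (F (alg_unit d n p)) (G (alg_unit d n q))))"

definition mult_map :: "nat \<Rightarrow> (nat \<Rightarrow> nat) \<Rightarrow> tensor \<Rightarrow> alg" where
  "mult_map d n T = alg_lincomb d n (unit_indices d n \<times> unit_indices d n)
     (\<lambda>(p, q). T p q) (\<lambda>(p, q). alg_mult d (alg_unit d n p) (alg_unit d n q))"

definition left_act :: "nat \<Rightarrow> (nat \<Rightarrow> nat) \<Rightarrow> alg \<Rightarrow> tensor \<Rightarrow> tensor" where
  "left_act d n x = tensor_map d n (\<lambda>u. alg_mult d x u) (\<lambda>v. v)"

definition right_act :: "nat \<Rightarrow> (nat \<Rightarrow> nat) \<Rightarrow> tensor \<Rightarrow> alg \<Rightarrow> tensor" where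
  "right_act d n T y = tensor_map d n (\<lambda>u. u) (\<lambda>v. alg_mult d v y) T"

text \<open>The scalar inner product of \<open>L\<^sup>2 \<otimes> L\<^sup>2\<close>, with
  \<open>\<langle>x \<otimes> y, z \<otimes> w\<rangle> = \<psi>(x\<^sup>* z) \<psi>(y\<^sup>* w)\<close>.\<close>

definition tensor_inner ::
  "nat \<Rightarrow> (nat \<Rightarrow> nat) \<Rightarrow> (nat \<Rightarrow> complex mat) \<Rightarrow> tensor \<Rightarrow> tensor \<Rightarrow> complex" where
  "tensor_inner d n \<rho> S T =
     (\<Sum>(p, q)\<in>unit_indices d n \<times> unit_indices d n. \<Sum>(r, s)\<in>unit_indices d n \<times> unit_indices d n.
        cnj (S p q) * T r s *
        (alg_inner d \<rho> (alg_unit d n p) (alg_unit d n r) *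
         alg_inner d \<rho> (alg_unit d n q) (alg_unit d n s)))"

text \<open>The algebra-valued inner product of \<open>B \<otimes>\<^sub>\<psi> B\<close>, with
  \<open>\<langle>x \<otimes> y, z \<otimes> w\<rangle> = \<psi>(x\<^sup>* z) y\<^sup>* w\<close>.\<close>

definition corr_inner ::
  "nat \<Rightarrow> (nat \<Rightarrow> nat) \<Rightarrow> (nat \<Rightarrow> complex mat) \<Rightarrow> tensor \<Rightarrow> tensor \<Rightarrow> alg" where
  "corr_inner d n \<rho> S T =
     alg_lincomb d n
       ((unit_indices d n \<times> unit_indices d n) \<times> (unit_indices d n \<times> unit_indices d n))
       (\<lambda>((p, q), (r, s)).
          cnj (S p q) * T r s * alg_state d \<rho> (alg_mult d (alg_star d (alg_unit d n p)) (alg_unit d n r)))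
       (\<lambda>((p, q), (r, s)). alg_mult d (alg_star d (alg_unit d n q)) (alg_unit d n s))"


section \<open>Quantum graphs\<close>

text \<open>The Hilbert space adjoint of the multiplication map, characterised by
  \<open>\<langle>m\<^sup>* x, S\<rangle> = \<langle>x, m S\<rangle>\<close>; it exists uniquely because the state is faithful.\<close>

definition mult_adj ::
  "nat \<Rightarrow> (nat \<Rightarrow> nat) \<Rightarrow> (nat \<Rightarrow> complex mat) \<Rightarrow> alg \<Rightarrow> tensor" where
  "mult_adj d n \<rho> x = (THE T. T \<in> tensor_carrier d n \<and>
     (\<forall>S\<in>tensor_carrier d n. tensor_inner d n \<rho> T S = alg_inner d \<rho> x (mult_map d n S)))"

definition delta_form ::
  "nat \<Rightarrow> (nat \<Rightarrow> nat) \<Rightarrow> (nat \<Rightarrow> complex mat) \<Rightarrow> real \<Rightarrow> bool" where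
  "delta_form d n \<rho> \<delta> \<longleftrightarrow> \<delta> > 0 \<and> state_density d n \<rho> \<and>
     (\<forall>x\<in>alg_carrier d n. mult_map d n (mult_adj d n \<rho> x) = alg_scale d (of_real (\<delta>\<^sup>2)) x)"

definition quantum_graph ::
  "nat \<Rightarrow> (nat \<Rightarrow> nat) \<Rightarrow> (nat \<Rightarrow> complex mat) \<Rightarrow> real \<Rightarrow> (alg \<Rightarrow> alg) \<Rightarrow> bool" where
  "quantum_graph d n \<rho> \<delta> A \<longleftrightarrow> (\<forall>a<d. n a > 0) \<and> delta_form d n \<rho> \<delta> \<and>
     alg_linear d n A \<and> star_preserving d n A \<and>
     (\<forall>x\<in>alg_carrier d n.
        mult_map d n (tensor_map d n A A (mult_adj d n \<rho> x)) = alg_scale d (of_real (\<delta>\<^sup>2)) (A x))"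

definition edge_indicator ::
  "nat \<Rightarrow> (nat \<Rightarrow> nat) \<Rightarrow> (nat \<Rightarrow> complex mat) \<Rightarrow> real \<Rightarrow> (alg \<Rightarrow> alg) \<Rightarrow> tensor" where
  "edge_indicator d n \<rho> \<delta> A = tensor_scale (of_real (1 / \<delta>\<^sup>2))
     (tensor_map d n (\<lambda>x. x) A (mult_adj d n \<rho> (alg_one d n)))"

definition edge_corr ::
  "nat \<Rightarrow> (nat \<Rightarrow> nat) \<Rightarrow> (nat \<Rightarrow> complex mat) \<Rightarrow> real \<Rightarrow> (alg \<Rightarrow> alg) \<Rightarrow> tensor set" where
  "edge_corr d n \<rho> \<delta> A = tensor.span
     {left_act d n x (right_act d n (edge_indicator d n \<rho> \<delta> A) y) | x y.
        x \<in> alg_carrier d n \<and> y \<in> alg_carrier d n}"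


section \<open>Orthonormal bases of submodules of \<open>B \<otimes>\<^sub>\<psi> B\<close>\<close>

definition right_module_span ::
  "nat \<Rightarrow> (nat \<Rightarrow> nat) \<Rightarrow> 'k set \<Rightarrow> ('k \<Rightarrow> tensor) \<Rightarrow> tensor set" where
  "right_module_span d n I \<phi> =
     {\<Sum>k\<in>F. right_act d n (\<phi> k) (y k) | F y. finite F \<and> F \<subseteq> I \<and> (\<forall>k\<in>F. y k \<in> alg_carrier d n)}"

definition module_orthonormal_basis ::
  "nat \<Rightarrow> (nat \<Rightarrow> nat) \<Rightarrow> (nat \<Rightarrow> complex mat) \<Rightarrow> tensor set \<Rightarrow> 'k set \<Rightarrow> ('k \<Rightarrow> tensor) \<Rightarrow> bool" where
  "module_orthonormal_basis d n \<rho> E I \<phi> \<longleftrightarrow>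
     (\<forall>k\<in>I. \<phi> k \<in> E) \<and>
     (\<forall>k\<in>I. \<forall>l\<in>I. k \<noteq> l \<longrightarrow> corr_inner d n \<rho> (\<phi> k) (\<phi> l) = alg_zero d n) \<and>
     (\<forall>k\<in>I. alg_projection d n (corr_inner d n \<rho> (\<phi> k) (\<phi> k))) \<and>
     right_module_span d n I \<phi> = E"

text \<open>With matrix indices starting at \<open>0\<close>, the unit \<open>e\<^sub>k\<^sub>1\<close> of the \<open>n a \<times> n b\<close> matrices is
  \<open>mat_unit (n a) (n b) k 0\<close>.\<close>

definition edge_basis ::
  "nat \<Rightarrow> (nat \<Rightarrow> nat) \<Rightarrow> (nat \<Rightarrow> complex mat) \<Rightarrow> real \<Rightarrow> (nat \<Rightarrow> nat \<Rightarrow> 'r \<Rightarrow> complex mat) \<Rightarrow>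
   nat \<Rightarrow> nat \<Rightarrow> nat \<Rightarrow> 'r \<Rightarrow> tensor" where
  "edge_basis d n \<rho> \<delta> V a b i r = tensor_scale (of_real (1 / \<delta>))
     (\<Sum>k<n a. tensor_prod d n
        (alg_embed d n a (mat_unit (n a) (n a) i k * mat_inv (\<rho> a)))
        (alg_embed d n b (V b a r * mat_unit (n a) (n b) k 0)))"

end

theory Submission
  imports Defs
begin

text \<open>
  Since the density is diagonal, the matrix units \<open>e\<^sub>p\<close> are orthogonal for the state, with
  \<open>\<parallel>e\<^sub>i\<^sub>j\<parallel>\<^sup>2 = \<rho>\<^sub>j\<close>, so everything can be read off in coordinates (counted from \<open>1\<close> in the formulas that follow). In particular
  \<open>m\<^sup>*(1) = \<Sum> e\<^sub>i\<^sub>j \<rho>\<^sup>-\<^sup>1 \<otimes> e\<^sub>j\<^sub>i\<close>, and inserting a Kraus decomposition of \<open>A\<close> gives, up to the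
  factor \<open>\<delta>\<^sup>-\<^sup>2\<close>,

  \<open>x \<epsilon> y = \<Sum>\<^sub>j\<^sub>,\<^sub>k\<^sub>,\<^sub>r x e\<^sub>j\<^sub>k \<rho>\<^sup>-\<^sup>1 \<otimes> V\<^sup>r e\<^sub>k\<^sub>j V\<^sup>r\<^sup>* y\<close>.

  In the second leg \<open>e\<^sub>k\<^sub>j = e\<^sub>k\<^sub>1 e\<^sub>1\<^sub>j\<close>, and \<open>V\<^sup>r e\<^sub>k\<^sub>1\<close> is exactly what enters \<open>\<phi>\<^sup>i\<^sup>r\<close>. So
  \<open>x \<epsilon> y = \<Sum> \<phi>\<^sup>i\<^sup>r z\<^sub>i\<^sub>r\<close>, where \<open>\<delta> z\<^sub>i\<^sub>r\<close> carries the \<open>i\<close>-th row of \<open>x V\<^sup>r\<^sup>* y\<close> in its first row and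
  is zero elsewhere. This is the inclusion of the edge correspondence in the right module spanned
  by the family (\<open>generator_in_right_span\<close>).

  For the reverse inclusion one has to separate the Kraus index from the sum over \<open>r\<close>, and for this
  the normalisation \<open>Tr (\<rho>\<^sup>-\<^sup>1 V\<^sup>r\<^sup>* V\<^sup>q) = \<delta>\<^sup>2 [r = q]\<close> is used: contracting
  \<open>e\<^sub>i\<^sub>j \<epsilon> e\<^sub>s\<^sub>1\<close> against the coefficients \<open>V\<^sup>r\<^sub>s\<^sub>j / \<rho>\<^sub>j\<close> annihilates all terms but the one of \<open>r\<close>, which
  is \<open>\<delta> \<phi>\<^sup>i\<^sup>r\<close> (\<open>phi_in_edge_corr\<close>). The edge correspondence is closed under the right action, so it
  contains the right module spanned by the family (\<open>right_act_edge_corr\<close>).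

  The same trace is the only entry that survives in an inner product of two members:
  \<open>\<langle>\<phi>\<^sup>i\<^sup>r, \<phi>\<^sup>j\<^sup>q\<rangle> = [i = j] \<delta>\<^sup>-\<^sup>2 Tr (\<rho>\<^sup>-\<^sup>1 V\<^sup>r\<^sup>* V\<^sup>q) e\<^sub>1\<^sub>1\<close> within one pair of blocks, and members of different
  pairs of blocks are orthogonal (\<open>phi_corr_inner\<close>). Hence the members are orthogonal, each with
  the projection \<open>e\<^sub>1\<^sub>1\<close> of the second block as its square.
\<close>

section \<open>Kronecker deltas and matrix entries\<close>

text \<open>Products and sums of coordinates of matrix units are full of zero-or-value conditionals. The rules
here move the conditions outwards until a single Kronecker delta is left under each sum.\<close>

lemma mult_if_zero:
  "(x :: complex) * (if P then y else 0) = (if P then x * y else 0)"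
  "(if P then y else 0) * (x :: complex) = (if P then y * x else 0)"
  by auto

lemma cnj_if_one: "cnj (if P then 1 else 0) = (if P then 1 else 0)"
  by simp

lemma if_product:
  "w * (cnj (if P then x else 0) * (if Q then y else 0)) =
    (if P \<and> Q then w * (cnj x * y) else 0)"
  by simp

lemma nested_if:
  "(if P then if Q then if R then x else y else y else y) = (if P \<and> Q \<and> R then x else y)"
  by simp

lemma sum_if_const: "(\<Sum>x\<in>S. if P then f x else (0 :: complex)) = (if P then \<Sum>x\<in>S. f x else 0)"
  by simp

text \<open>One summand of \<open>\<langle>\<phi>, \<phi>'\<rangle>\<close>: two factors \<open>\<rho>\<^sup>-\<^sup>1\<close> against the weight \<open>\<rho>\<close> of the state leave the single
\<open>\<rho>\<^sup>-\<^sup>1\<close> of the Kraus normalisation. Here \<open>w\<close> is the entry of \<open>\<rho>\<close>, and \<open>t\<close> is \<open>\<delta>\<close>.\<close>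

lemma weighted_product:
  fixes w :: complex
  assumes "w \<noteq> 0" "cnj w = w"
  shows "w * (cnj (1 / of_real t * (u / w)) * (1 / of_real t * (v / w))) =
    1 / (of_real t)\<^sup>2 * (cnj u * v / w)"
proof -
  have "w * (cnj (1 / of_real t * (u / w)) * (1 / of_real t * (v / w))) =
      w * (1 / of_real t * (cnj u / w) * (1 / of_real t * (v / w)))"
    by (simp only: complex_cnj_mult complex_cnj_divide complex_cnj_one complex_cnj_complex_of_real
      assms(2))
  then show ?thesis
    using assms(1) by (simp add: power2_eq_square)
qed

lemma mat_mult_entry:
  fixes M :: "complex mat"
  assumes "M \<in> carrier_mat r k" "N \<in> carrier_mat k c" "i < r" "j < c"
  shows "(M * N) $$ (i, j) = (\<Sum>m<k. M $$ (i, m) * N $$ (m, j))"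
  using assms by (simp add: scalar_prod_def atLeast0LessThan)

lemma mat_unit_carrier [simp]: "mat_unit r c i j \<in> carrier_mat r c"
  by (simp add: mat_unit_def)

lemma mat_unit_entry:
  "k < r \<Longrightarrow> l < c \<Longrightarrow> mat_unit r c i j $$ (k, l) = (if k = i \<and> l = j then 1 else 0)"
  by (simp add: mat_unit_def)

lemma mat_adjoint_entry:
  fixes M :: "complex mat"
  assumes "i < dim_col M" "j < dim_row M"
  shows "mat_adjoint M $$ (i, j) = cnj (M $$ (j, i))"
  using assms by (simp add: mat_adjoint_def mat_of_rows_def conjugate_complex_def)

lemma mat_adjoint_carrier [simp]: "M \<in> carrier_mat r c \<Longrightarrow> mat_adjoint M \<in> carrier_mat c r"
  by (auto simp: mat_adjoint_def)

text \<open>If row \<open>i\<close> of \<open>M\<close> vanishes off the diagonal, the diagonal entry of \<open>M N\<close> at \<open>i\<close> is \<open>M\<^sub>i\<^sub>i N\<^sub>i\<^sub>i\<close>.\<close>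

lemma diagonal_entry_nonzero:
  assumes "M \<in> carrier_mat k k" "invertible_mat (M :: complex mat)"
    and "\<And>j. j < k \<Longrightarrow> i \<noteq> j \<Longrightarrow> M $$ (i, j) = 0" and "i < k"
  shows "M $$ (i, i) \<noteq> 0"
proof -
  obtain N where N: "M * N = 1\<^sub>m k" "N * M = 1\<^sub>m (dim_row N)"
    using assms(1,2) by (auto simp: invertible_mat_def inverts_mat_def)
  have dim: "dim_col N = k" "dim_row N = k"
    using arg_cong[OF N(1), of dim_col] arg_cong[OF N(2), of dim_col] assms(1) by auto
  have "(M * N) $$ (i, i) = (\<Sum>m<k. M $$ (i, m) * N $$ (m, i))"
    using assms(1,4) dim by (simp add: scalar_prod_def atLeast0LessThan)
  also have "\<dots> = (\<Sum>m<k. if m = i then M $$ (i, i) * N $$ (i, i) else 0)"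
    using assms(3) by (intro sum.cong) auto
  finally show ?thesis using N(1) assms(4) by auto
qed

lemma pos_mat_diagonal_real:
  assumes "pos_mat k M" "i < k"
  shows "cnj (M $$ (i, i)) = M $$ (i, i)"
proof -
  have M: "M \<in> carrier_mat k k" and "0 \<le> (M *\<^sub>v unit_vec k i) \<bullet>c unit_vec k i"
    using assms by (auto simp: pos_mat_def)
  moreover have "(M *\<^sub>v unit_vec k i) \<bullet>c unit_vec k i = M $$ (i, i)"
  proof -
    have "(M *\<^sub>v unit_vec k i) \<bullet>c unit_vec k i = (\<Sum>m<k. if m = i then M $$ (i, i) else 0)"
      using M assms(2) by (simp add: scalar_prod_def atLeast0LessThan unit_vec_def mult_if_zero
        cnj_if_one conjugate_complex_def)
    then show ?thesis using assms(2) by simp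
  qed
  ultimately show ?thesis
    by (auto simp: complex_eq_iff less_eq_complex_def)
qed

section \<open>The algebra in matrix coordinates\<close>

lemma finite_unit_indices [simp]: "finite (unit_indices d n)"
  by (simp add: unit_indices_def)

lemma mem_unit_indices [simp]:
  "(a, i, j) \<in> unit_indices d n \<longleftrightarrow> a < d \<and> i < n a \<and> j < n a"
  by (auto simp: unit_indices_def)

lemma sum_unit_indices:
  "(\<Sum>p\<in>unit_indices d n. f p) = (\<Sum>a<d. \<Sum>i<n a. \<Sum>j<n a. f (a, i, j))"
proof -
  have "(\<Sum>p\<in>unit_indices d n. f p) = (\<Sum>a<d. \<Sum>q\<in>{..<n a} \<times> {..<n a}. f (a, q))"
    unfolding unit_indices_def by (subst sum.Sigma) (auto simp: split_def)
  then show ?thesis by (simp add: sum.cartesian_product split_def)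
qed

lemma alg_carrier_block: "x \<in> alg_carrier d n \<Longrightarrow> a < d \<Longrightarrow> x a \<in> carrier_mat (n a) (n a)"
  by (auto simp: alg_carrier_def)

lemma alg_carrier_dim:
  assumes "x \<in> alg_carrier d n" "a < d"
  shows "dim_row (x a) = n a" "dim_col (x a) = n a"
  using alg_carrier_block[OF assms] by auto

lemma alg_eqI:
  assumes "x \<in> alg_carrier d n" "y \<in> alg_carrier d n"
    and "\<And>a i j. a < d \<Longrightarrow> i < n a \<Longrightarrow> j < n a \<Longrightarrow> x a $$ (i, j) = y a $$ (i, j)"
  shows "x = y"
  using assms(1,2) unfolding alg_carrier_def
proof (rule PiE_ext)
  fix a assume "a \<in> {..<d}"
  then show "x a = y a"
    using assms alg_carrier_dim[of x d n a] alg_carrier_dim[of y d n a] by (intro eq_matI) auto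
qed

lemma zero_in_carrier [simp]: "alg_zero d n \<in> alg_carrier d n"
  by (auto simp: alg_zero_def alg_carrier_def)

lemma one_in_carrier [simp]: "alg_one d n \<in> alg_carrier d n"
  by (auto simp: alg_one_def alg_carrier_def)

lemma add_in_carrier [simp]:
  "x \<in> alg_carrier d n \<Longrightarrow> y \<in> alg_carrier d n \<Longrightarrow> alg_add d x y \<in> alg_carrier d n"
  using alg_carrier_block[of x d n] alg_carrier_block[of y d n]
  by (auto simp: alg_add_def alg_carrier_def intro!: add_carrier_mat)

lemma scale_in_carrier [simp]: "x \<in> alg_carrier d n \<Longrightarrow> alg_scale d c x \<in> alg_carrier d n"
  using alg_carrier_block[of x d n]
  by (auto simp: alg_scale_def alg_carrier_def intro!: smult_carrier_mat)

lemma mult_in_carrier [simp]: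
  "x \<in> alg_carrier d n \<Longrightarrow> y \<in> alg_carrier d n \<Longrightarrow> alg_mult d x y \<in> alg_carrier d n"
  using alg_carrier_block[of x d n] alg_carrier_block[of y d n]
  by (auto simp: alg_mult_def alg_carrier_def intro!: mult_carrier_mat)

lemma star_in_carrier [simp]: "x \<in> alg_carrier d n \<Longrightarrow> alg_star d x \<in> alg_carrier d n"
  using alg_carrier_block[of x d n]
  by (auto simp: alg_star_def alg_carrier_def intro!: mat_adjoint_carrier)

lemma lincomb_in_carrier [simp]: "alg_lincomb d n S c x \<in> alg_carrier d n"
  by (auto simp: alg_lincomb_def alg_carrier_def mat_sum_def)

lemma mult_block_entry:
  assumes "x \<in> alg_carrier d n" "y \<in> alg_carrier d n" "a < d" "i < n a" "j < n a"
  shows "alg_mult d x y a $$ (i, j) = (\<Sum>m<n a. x a $$ (i, m) * y a $$ (m, j))"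
  using assms alg_carrier_dim[of x d n a] alg_carrier_dim[of y d n a]
  by (simp add: alg_mult_def scalar_prod_def atLeast0LessThan)

lemma star_entry:
  "x \<in> alg_carrier d n \<Longrightarrow> a < d \<Longrightarrow> i < n a \<Longrightarrow> j < n a \<Longrightarrow>
     alg_star d x a $$ (i, j) = cnj (x a $$ (j, i))"
  using alg_carrier_dim[of x d n a] by (simp add: alg_star_def mat_adjoint_entry)

lemma lincomb_entry:
  assumes "a < d" "i < n a" "j < n a" "\<And>s. s \<in> S \<Longrightarrow> x s \<in> alg_carrier d n"
  shows "alg_lincomb d n S c x a $$ (i, j) = (\<Sum>s\<in>S. c s * x s a $$ (i, j))"
proof -
  have "dim_row (x s a) = n a \<and> dim_col (x s a) = n a" if "s \<in> S" for s
    using alg_carrier_dim[OF assms(4)[OF that] assms(1)] by simp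
  then show ?thesis
    using assms(1-3) by (auto simp: alg_lincomb_def mat_sum_def intro!: sum.cong)
qed

lemma alg_unit_block:
  "c < d \<Longrightarrow> alg_unit d n (a, i, j) c =
     mat (n c) (n c) (\<lambda>(k, l). if a = c \<and> k = i \<and> l = j then 1 else 0)"
  by (auto simp: alg_unit_def alg_embed_def mat_unit_def)

lemma unit_entry:
  assumes "c < d" "k < n c" "l < n c"
  shows "alg_unit d n p c $$ (k, l) = (if p = (c, k, l) then 1 else 0)"
  using assms by (cases p) (auto simp: alg_unit_block)

lemma alg_coord_unit [simp]:
  "p \<in> unit_indices d n \<Longrightarrow> alg_coord (alg_unit d n q) p = (if q = p then 1 else 0)"
  by (cases p; cases q) (auto simp: alg_coord_def alg_unit_block)

lemma unit_in_carrier [simp]: "alg_unit d n p \<in> alg_carrier d n"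
  by (cases p) (auto simp: alg_carrier_def alg_unit_def alg_embed_def mat_unit_def)

lemma coord_mult_unit_right:
  assumes "x \<in> alg_carrier d n" "(a, i, j) \<in> unit_indices d n" "(b, k, l) \<in> unit_indices d n"
  shows "alg_coord (alg_mult d x (alg_unit d n (b, k, l))) (a, i, j) =
     (if b = a then if l = j then x a $$ (i, k) else 0 else 0)"
  using assms by (cases "b = a"; cases "l = j")
    (simp_all add: alg_coord_def mult_block_entry[where n = n] unit_entry mult_if_zero)

lemma coord_mult_unit_left:
  assumes "x \<in> alg_carrier d n" "(a, i, j) \<in> unit_indices d n" "(b, k, l) \<in> unit_indices d n"
  shows "alg_coord (alg_mult d (alg_unit d n (b, k, l)) x) (a, i, j) =
     (if b = a then if k = i then x a $$ (l, j) else 0 else 0)"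
  using assms by (cases "b = a"; cases "k = i")
    (simp_all add: alg_coord_def mult_block_entry[where n = n] unit_entry mult_if_zero)

text \<open>These are the projections that occur as inner squares of the basis elements.\<close>

lemma projection_diagonal_unit:
  assumes "a < d" "i < n a"
  shows "alg_projection d n (alg_unit d n (a, i, i))"
proof -
  have "alg_mult d (alg_unit d n (a, i, i)) (alg_unit d n (a, i, i)) = alg_unit d n (a, i, i)"
  proof (rule alg_eqI)
    fix c k l assume c: "c < d" "k < n c" "l < n c"
    have "alg_mult d (alg_unit d n (a, i, i)) (alg_unit d n (a, i, i)) c $$ (k, l) =
        (\<Sum>m<n c. if m = i then if a = c \<and> i = k \<and> i = l then 1 else 0 else 0)"
      unfolding mult_block_entry[where n = n and d = d, OF unit_in_carrier unit_in_carrier c]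
      using c by (intro sum.cong refl) (auto simp: unit_entry)
    then show "alg_mult d (alg_unit d n (a, i, i)) (alg_unit d n (a, i, i)) c $$ (k, l) =
        alg_unit d n (a, i, i) c $$ (k, l)"
      using c by (auto simp: unit_entry)
  qed simp_all
  moreover have "alg_star d (alg_unit d n (a, i, i)) = alg_unit d n (a, i, i)"
    by (rule alg_eqI[where d = d and n = n]) (auto simp: star_entry[OF unit_in_carrier] unit_entry)
  ultimately show ?thesis
    by (simp add: alg_projection_def)
qed

section \<open>Tensors and the bimodule actions\<close>

lemma tensor_sum_apply: "(\<Sum>s\<in>S. T s) p q = (\<Sum>s\<in>S. (T s :: tensor) p q)"
  by (induction S rule: infinite_finite_induct) simp_all

lemma tensor_map_apply:
  "tensor_map d n F G T p q =
     (if p \<in> unit_indices d n \<and> q \<in> unit_indices d n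
      then \<Sum>r\<in>unit_indices d n. \<Sum>s\<in>unit_indices d n.
             T r s * (alg_coord (F (alg_unit d n r)) p * alg_coord (G (alg_unit d n s)) q)
      else 0)"
  unfolding tensor_map_def tensor_sum_apply split_def
  by (auto simp: tensor_scale_def tensor_prod_def sum.cartesian_product split_def)

lemma mult_map_in_carrier [simp]: "mult_map d n T \<in> alg_carrier d n"
  by (simp add: mult_map_def)

text \<open>The multiplication map contracts the column index of the first leg with the row index of the second
leg, within one block.\<close>

lemma mult_map_entry:
  assumes "a < d" "i < n a" "l < n a"
  shows "mult_map d n T a $$ (i, l) = (\<Sum>j<n a. T (a, i, j) (a, j, l))"
proof -
  have unit: "alg_mult d (alg_unit d n p) (alg_unit d n q) a $$ (i, l) =
      (\<Sum>j<n a. if q = (a, j, l) then if p = (a, i, j) then 1 else 0 else 0)" for p q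
    unfolding mult_block_entry[where n = n and d = d, OF unit_in_carrier unit_in_carrier assms]
    by (intro sum.cong refl) (simp add: unit_entry assms)
  have "mult_map d n T a $$ (i, l) = (\<Sum>p\<in>unit_indices d n. \<Sum>q\<in>unit_indices d n.
      T p q * alg_mult d (alg_unit d n p) (alg_unit d n q) a $$ (i, l))"
    unfolding mult_map_def using assms
    by (subst lincomb_entry) (auto simp: sum.cartesian_product' simp del: sum.cartesian_product)
  also have "\<dots> = (\<Sum>p\<in>unit_indices d n. \<Sum>q\<in>unit_indices d n.
      \<Sum>j<n a. if q = (a, j, l) then if p = (a, i, j) then T p q else 0 else 0)"
    unfolding unit sum_distrib_left by (intro sum.cong refl) simp
  also have "\<dots> = (\<Sum>p\<in>unit_indices d n. \<Sum>j<n a. if p = (a, i, j) then T p (a, j, l) else 0)"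
    using assms by (intro sum.cong refl, subst sum.swap) (simp add: sum.delta)
  also have "\<dots> = (\<Sum>j<n a. T (a, i, j) (a, j, l))"
    using assms by (subst sum.swap) simp
  finally show ?thesis .
qed

text \<open>The left action is matrix multiplication on the first leg alone, the right action matrix
multiplication on the second leg alone; the other index pair is a spectator.\<close>

lemma left_act_apply:
  assumes "x \<in> alg_carrier d n" "(a, i, j) \<in> unit_indices d n" "q \<in> unit_indices d n"
  shows "left_act d n x T (a, i, j) q = (\<Sum>m<n a. x a $$ (i, m) * T (a, m, j) q)"
proof -
  have "left_act d n x T (a, i, j) q = (\<Sum>r\<in>unit_indices d n. T r q *
     alg_coord (alg_mult d x (alg_unit d n r)) (a, i, j))"
    using assms by (simp add: left_act_def tensor_map_apply mult_if_zero)
  also have "\<dots> = (\<Sum>c<d. \<Sum>k<n c. \<Sum>l<n c.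
      if c = a then if l = j then T (c, k, l) q * x a $$ (i, k) else 0 else 0)"
    unfolding sum_unit_indices using assms
    by (intro sum.cong refl) (simp add: coord_mult_unit_right)
  also have "\<dots> = (\<Sum>c<d. if c = a then (\<Sum>m<n a. x a $$ (i, m) * T (a, m, j) q) else 0)"
    using assms by (intro sum.cong refl) (auto simp: mult.commute)
  finally show ?thesis using assms by simp
qed

lemma right_act_apply:
  assumes "y \<in> alg_carrier d n" "p \<in> unit_indices d n" "(b, k, l) \<in> unit_indices d n"
  shows "right_act d n T y p (b, k, l) = (\<Sum>m<n b. T p (b, k, m) * y b $$ (m, l))"
proof -
  have "right_act d n T y p (b, k, l) = (\<Sum>r\<in>unit_indices d n. T p r *
     alg_coord (alg_mult d (alg_unit d n r) y) (b, k, l))"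
    unfolding right_act_def tensor_map_apply using assms
    by (subst sum.swap) (simp add: mult_if_zero)
  also have "\<dots> = (\<Sum>c<d. \<Sum>k'<n c. \<Sum>l'<n c.
      if c = b then if k' = k then T p (c, k', l') * y b $$ (l', l) else 0 else 0)"
    unfolding sum_unit_indices using assms
    by (intro sum.cong refl) (simp add: coord_mult_unit_left)
  also have "\<dots> = (\<Sum>c<d. if c = b then (\<Sum>m<n b. T p (b, k, m) * y b $$ (m, l)) else 0)"
    using assms by (intro sum.cong refl, subst sum.swap) auto
  finally show ?thesis using assms by simp
qed

lemma act_outside:
  assumes "p \<notin> unit_indices d n \<or> q \<notin> unit_indices d n"
  shows "left_act d n x T p q = 0" "right_act d n T y p q = 0"
  using assms by (auto simp: left_act_def right_act_def tensor_map_apply)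

lemma tensor_eqI:
  assumes "S \<in> tensor_carrier d n" "T \<in> tensor_carrier d n"
    and "\<And>a i j b k l. (a, i, j) \<in> unit_indices d n \<Longrightarrow> (b, k, l) \<in> unit_indices d n \<Longrightarrow>
      S (a, i, j) (b, k, l) = T (a, i, j) (b, k, l)"
  shows "S = T"
proof (intro ext)
  fix p q
  show "S p q = T p q"
    using assms by (cases p; cases q; cases "p \<in> unit_indices d n \<and> q \<in> unit_indices d n")
      (auto simp: tensor_carrier_def)
qed

lemma tensor_carrier_outside:
  "T \<in> tensor_carrier d n \<Longrightarrow> p \<notin> unit_indices d n \<or> q \<notin> unit_indices d n \<Longrightarrow> T p q = 0"
  unfolding tensor_carrier_def by blast

lemma act_in_carrier [simp]:
  "left_act d n x T \<in> tensor_carrier d n" "right_act d n T y \<in> tensor_carrier d n"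
  by (auto simp: tensor_carrier_def act_outside)

lemma subspace_tensor_carrier: "tensor.subspace (tensor_carrier d n)"
  by (auto simp: tensor.subspace_def tensor_carrier_def tensor_scale_def)

lemmas tensor_carrier_closed [simp] =
  tensor.subspace_0[OF subspace_tensor_carrier]
  tensor.subspace_add[OF subspace_tensor_carrier]
  tensor.subspace_scale[OF subspace_tensor_carrier]

lemma right_act_zero: "right_act d n T (alg_zero d n) = 0"
proof (rule tensor_eqI[where d = d and n = n])
  fix a i j b k l
  assume U: "(a, i, j) \<in> unit_indices d n" "(b, k, l) \<in> unit_indices d n"
  show "right_act d n T (alg_zero d n) (a, i, j) (b, k, l) = 0 (a, i, j) (b, k, l)"
    unfolding right_act_apply[OF zero_in_carrier U] using U by (simp add: alg_zero_def)
qed simp_all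

lemma right_act_add:
  assumes "y \<in> alg_carrier d n" "z \<in> alg_carrier d n"
  shows "right_act d n T (alg_add d y z) = right_act d n T y + right_act d n T z"
proof (rule tensor_eqI[where d = d and n = n])
  fix a i j b k l
  assume U: "(a, i, j) \<in> unit_indices d n" "(b, k, l) \<in> unit_indices d n"
  then have dim: "dim_row (y b) = n b" "dim_col (y b) = n b" "dim_row (z b) = n b" "dim_col (z b) = n b"
    using alg_carrier_dim[OF assms(1)] alg_carrier_dim[OF assms(2)] by auto
  show "right_act d n T (alg_add d y z) (a, i, j) (b, k, l) =
      (right_act d n T y + right_act d n T z) (a, i, j) (b, k, l)"
    unfolding plus_fun_apply right_act_apply[OF add_in_carrier[OF assms] U]
      right_act_apply[OF assms(1) U] right_act_apply[OF assms(2) U]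
    using U dim by (simp add: alg_add_def distrib_left sum.distrib)
qed simp_all

lemma right_act_scale:
  assumes "y \<in> alg_carrier d n"
  shows "right_act d n T (alg_scale d c y) = tensor_scale c (right_act d n T y)"
proof (rule tensor_eqI[where d = d and n = n])
  fix a i j b k l
  assume U: "(a, i, j) \<in> unit_indices d n" "(b, k, l) \<in> unit_indices d n"
  then have dim: "dim_row (y b) = n b" "dim_col (y b) = n b"
    using alg_carrier_dim[OF assms] by auto
  show "right_act d n T (alg_scale d c y) (a, i, j) (b, k, l) =
      tensor_scale c (right_act d n T y) (a, i, j) (b, k, l)"
    unfolding tensor_scale_def right_act_apply[OF scale_in_carrier[OF assms] U]
      right_act_apply[OF assms U]
    using U dim by (simp add: alg_scale_def sum_distrib_left mult_ac)
qed simp_all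

lemma right_act_zero_left: "right_act d n 0 y = 0"
  by (intro ext) (simp add: right_act_def tensor_map_apply)

lemma right_act_linear_left:
  assumes "y \<in> alg_carrier d n"
  shows "right_act d n (tensor_scale c S + T) y =
    tensor_scale c (right_act d n S y) + right_act d n T y"
proof (rule tensor_eqI[where d = d and n = n])
  fix a i j b k l
  assume U: "(a, i, j) \<in> unit_indices d n" "(b, k, l) \<in> unit_indices d n"
  show "right_act d n (tensor_scale c S + T) y (a, i, j) (b, k, l) =
      (tensor_scale c (right_act d n S y) + right_act d n T y) (a, i, j) (b, k, l)"
    by (simp add: right_act_apply[OF assms U] tensor_scale_def sum_distrib_left
      sum.distrib distrib_right mult.assoc)
qed simp_all

lemma right_act_bimodule:
  assumes "x \<in> alg_carrier d n" "z \<in> alg_carrier d n" "y \<in> alg_carrier d n"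
  shows "right_act d n (left_act d n x (right_act d n T z)) y =
    left_act d n x (right_act d n T (alg_mult d z y))"
proof (rule tensor_eqI[where d = d and n = n])
  fix a i j b k l
  assume U: "(a, i, j) \<in> unit_indices d n" "(b, k, l) \<in> unit_indices d n"
  let ?t = "\<lambda>m s t. x a $$ (i, m) * (T (a, m, j) (b, k, s) * (z b $$ (s, t) * y b $$ (t, l)))"
  have "right_act d n (left_act d n x (right_act d n T z)) y (a, i, j) (b, k, l) =
      (\<Sum>t<n b. \<Sum>m<n a. \<Sum>s<n b. ?t m s t)"
    using U by (simp add: right_act_apply[OF assms(3)] left_act_apply[OF assms(1)]
      right_act_apply[OF assms(2)] sum_distrib_left sum_distrib_right mult.assoc)
  also have "\<dots> = (\<Sum>m<n a. \<Sum>t<n b. \<Sum>s<n b. ?t m s t)"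
    by (rule sum.swap)
  also have "\<dots> = (\<Sum>m<n a. \<Sum>s<n b. \<Sum>t<n b. ?t m s t)"
    by (rule sum.cong[OF refl], rule sum.swap)
  also have "\<dots> = left_act d n x (right_act d n T (alg_mult d z y)) (a, i, j) (b, k, l)"
    using U by (simp add: right_act_apply[OF mult_in_carrier[OF assms(2,3)]] left_act_apply[OF assms(1)]
      mult_block_entry[OF assms(2,3)] sum_distrib_left)
  finally show "right_act d n (left_act d n x (right_act d n T z)) y (a, i, j) (b, k, l) = \<dots>" .
qed simp_all

section \<open>Right submodules\<close>

text \<open>For a finite family the coefficients outside the chosen finite subset can be filled up with zero, so
that all combinations run over the same index set and can be added term by term.\<close>

lemma right_module_span_finite:
  assumes "finite I"
  shows "right_module_span d n I \<phi> =
    {\<Sum>k\<in>I. right_act d n (\<phi> k) (y k) | y. \<forall>k\<in>I. y k \<in> alg_carrier d n}"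
proof (intro equalityI subsetI)
  fix T assume "T \<in> right_module_span d n I \<phi>"
  then obtain F y where F: "F \<subseteq> I" "\<forall>k\<in>F. y k \<in> alg_carrier d n"
    and T: "T = (\<Sum>k\<in>F. right_act d n (\<phi> k) (y k))"
    unfolding right_module_span_def by blast
  define y' where "y' k = (if k \<in> F then y k else alg_zero d n)" for k
  have "T = (\<Sum>k\<in>I. right_act d n (\<phi> k) (y' k))"
    unfolding T using F assms
    by (intro sum.mono_neutral_cong_left) (auto simp: y'_def right_act_zero)
  moreover have "\<forall>k\<in>I. y' k \<in> alg_carrier d n"
    using F by (simp add: y'_def)
  ultimately show "T \<in> {\<Sum>k\<in>I. right_act d n (\<phi> k) (y k) | y. \<forall>k\<in>I. y k \<in> alg_carrier d n}"
    by blast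
qed (use assms in \<open>auto simp: right_module_span_def\<close>)

lemma mem_right_module_span:
  assumes "finite I"
  shows "T \<in> right_module_span d n I \<phi> \<longleftrightarrow>
    (\<exists>y. T = (\<Sum>k\<in>I. right_act d n (\<phi> k) (y k)) \<and> (\<forall>k\<in>I. y k \<in> alg_carrier d n))"
  unfolding right_module_span_finite[OF assms] by (rule mem_Collect_eq)

lemma subspace_right_module_span:
  assumes "finite I"
  shows "tensor.subspace (right_module_span d n I \<phi>)"
  unfolding tensor.subspace_def
proof (intro conjI ballI allI)
  have "(0 :: tensor) = (\<Sum>k\<in>I. right_act d n (\<phi> k) (alg_zero d n))"
    by (simp add: right_act_zero)
  then show "0 \<in> right_module_span d n I \<phi>"
    unfolding mem_right_module_span[OF assms]
    by (intro exI[of _ "\<lambda>_. alg_zero d n"]) simp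
next
  fix S T assume "S \<in> right_module_span d n I \<phi>" "T \<in> right_module_span d n I \<phi>"
  then obtain y z
    where y: "S = (\<Sum>k\<in>I. right_act d n (\<phi> k) (y k))" "\<forall>k\<in>I. y k \<in> alg_carrier d n"
      and z: "T = (\<Sum>k\<in>I. right_act d n (\<phi> k) (z k))" "\<forall>k\<in>I. z k \<in> alg_carrier d n"
    unfolding mem_right_module_span[OF assms] by (elim exE conjE)
  have "S + T = (\<Sum>k\<in>I. right_act d n (\<phi> k) (alg_add d (y k) (z k)))"
    unfolding y(1) z(1) sum.distrib[symmetric]
    using y(2) z(2) by (intro sum.cong refl) (simp add: right_act_add)
  then show "S + T \<in> right_module_span d n I \<phi>"
    unfolding mem_right_module_span[OF assms]
    using y(2) z(2) by (intro exI[of _ "\<lambda>k. alg_add d (y k) (z k)"]) simp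
next
  fix c T assume "T \<in> right_module_span d n I \<phi>"
  then obtain y
    where y: "T = (\<Sum>k\<in>I. right_act d n (\<phi> k) (y k))" "\<forall>k\<in>I. y k \<in> alg_carrier d n"
    unfolding mem_right_module_span[OF assms] by (elim exE conjE)
  have "tensor_scale c T = (\<Sum>k\<in>I. right_act d n (\<phi> k) (alg_scale d c (y k)))"
    unfolding y(1) tensor.scale_sum_right
    using y(2) by (intro sum.cong refl) (simp add: right_act_scale)
  then show "tensor_scale c T \<in> right_module_span d n I \<phi>"
    unfolding mem_right_module_span[OF assms]
    using y(2) by (intro exI[of _ "\<lambda>k. alg_scale d c (y k)"]) simp
qed

lemma generator_in_edge_corr:
  assumes "x \<in> alg_carrier d n" "y \<in> alg_carrier d n"
  shows "left_act d n x (right_act d n (edge_indicator d n \<rho> \<delta> A) y) \<in> edge_corr d n \<rho> \<delta> A"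
  unfolding edge_corr_def
  by (rule tensor.span_base, rule CollectI, rule exI[of _ x], rule exI[of _ y]) (use assms in simp)

text \<open>Because \<open>(x \<epsilon> z) y = x \<epsilon> (z y)\<close>, the right action maps generators of the edge correspondence to
generators; by linearity it preserves their span.\<close>

lemma right_act_edge_corr:
  assumes T: "T \<in> edge_corr d n \<rho> \<delta> A" and y: "y \<in> alg_carrier d n"
  shows "right_act d n T y \<in> edge_corr d n \<rho> \<delta> A"
  using T unfolding edge_corr_def
proof (induction rule: tensor.span_induct_alt)
  case base
  show ?case unfolding right_act_zero_left by (rule tensor.span_zero)
next
  case (step c S T)
  then obtain x z where xz: "x \<in> alg_carrier d n" "z \<in> alg_carrier d n"
    and S: "S = left_act d n x (right_act d n (edge_indicator d n \<rho> \<delta> A) z)"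
    by blast
  have "right_act d n S y =
      left_act d n x (right_act d n (edge_indicator d n \<rho> \<delta> A) (alg_mult d z y))"
    unfolding S using xz y by (rule right_act_bimodule)
  moreover have "right_act d n (tensor_scale c S + T) y =
      tensor_scale c (right_act d n S y) + right_act d n T y"
    by (rule right_act_linear_left[OF y])
  ultimately have "right_act d n (tensor_scale c S + T) y =
      tensor_scale c (left_act d n x (right_act d n (edge_indicator d n \<rho> \<delta> A) (alg_mult d z y))) +
      right_act d n T y"
    by (simp only:)
  then show ?case
    using xz y mult_in_carrier
    by (simp only:) (rule tensor.span_add[OF tensor.span_scale[OF tensor.span_base] step.IH], blast)
qed

section \<open>Inner products for a diagonal density\<close>

text \<open>The consequences of positivity and invertibility that matter for a diagonal density: its diagonal
entries are real and can be divided by.\<close>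

locale diagonal_state =
  fixes d :: nat and n :: "nat \<Rightarrow> nat" and \<rho> :: "nat \<Rightarrow> complex mat"
  assumes density_carrier: "a < d \<Longrightarrow> \<rho> a \<in> carrier_mat (n a) (n a)"
    and density_off_diagonal: "a < d \<Longrightarrow> i < n a \<Longrightarrow> j < n a \<Longrightarrow> i \<noteq> j \<Longrightarrow> \<rho> a $$ (i, j) = 0"
    and density_nonzero: "a < d \<Longrightarrow> i < n a \<Longrightarrow> \<rho> a $$ (i, i) \<noteq> 0"
    and density_real: "a < d \<Longrightarrow> i < n a \<Longrightarrow> cnj (\<rho> a $$ (i, i)) = \<rho> a $$ (i, i)"
begin

abbreviation U :: "unit_index set" where "U \<equiv> unit_indices d n"

text \<open>The squared norm of the matrix unit with this index.\<close>

fun weight :: "unit_index \<Rightarrow> complex" where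
  "weight (a, i, j) = \<rho> a $$ (j, j)"

lemma weight_nonzero: "p \<in> U \<Longrightarrow> weight p \<noteq> 0"
  by (cases p) (auto simp: density_nonzero)

lemma state_entry:
  assumes "x \<in> alg_carrier d n"
  shows "alg_state d \<rho> x = (\<Sum>a<d. \<Sum>i<n a. \<rho> a $$ (i, i) * x a $$ (i, i))"
  unfolding alg_state_def
proof (rule sum.cong[OF refl])
  fix a assume a: "a \<in> {..<d}"
  have "(\<Sum>m<n a. \<rho> a $$ (i, m) * x a $$ (m, i)) = \<rho> a $$ (i, i) * x a $$ (i, i)"
    if "i < n a" for i
  proof -
    have "(\<Sum>m<n a. \<rho> a $$ (i, m) * x a $$ (m, i)) =
        (\<Sum>m<n a. if m = i then \<rho> a $$ (i, i) * x a $$ (i, i) else 0)"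
      using a that density_off_diagonal[of a i] by (intro sum.cong) auto
    then show ?thesis using that by simp
  qed
  then show "mat_trace (\<rho> a * x a) = (\<Sum>i<n a. \<rho> a $$ (i, i) * x a $$ (i, i))"
    using a density_carrier[of a] alg_carrier_dim[OF assms, of a]
    by (simp add: mat_trace_def scalar_prod_def atLeast0LessThan)
qed

lemma inner_coord:
  assumes "x \<in> alg_carrier d n" "y \<in> alg_carrier d n"
  shows "alg_inner d \<rho> x y = (\<Sum>p\<in>U. weight p * (cnj (alg_coord x p) * alg_coord y p))"
proof -
  have "alg_inner d \<rho> x y =
      (\<Sum>a<d. \<Sum>j<n a. \<Sum>i<n a. \<rho> a $$ (j, j) * (cnj (x a $$ (i, j)) * y a $$ (i, j)))"
    unfolding alg_inner_def
      state_entry[OF mult_in_carrier[OF star_in_carrier[OF assms(1)] assms(2)]]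
    by (rule sum.cong[OF refl], rule sum.cong[OF refl])
       (simp add: mult_block_entry[OF star_in_carrier[OF assms(1)] assms(2)]
         star_entry[OF assms(1)] sum_distrib_left)
  also have "\<dots> =
      (\<Sum>a<d. \<Sum>i<n a. \<Sum>j<n a. \<rho> a $$ (j, j) * (cnj (x a $$ (i, j)) * y a $$ (i, j)))"
    by (rule sum.cong[OF refl], rule sum.swap)
  finally show ?thesis by (simp add: sum_unit_indices alg_coord_def)
qed

lemma inner_units:
  assumes "p \<in> U" "q \<in> U"
  shows "alg_inner d \<rho> (alg_unit d n p) (alg_unit d n q) = (if p = q then weight p else 0)"
proof -
  have "alg_inner d \<rho> (alg_unit d n p) (alg_unit d n q) =
      (\<Sum>r\<in>U. if r = p then if p = q then weight p else 0 else 0)"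
    unfolding inner_coord[OF unit_in_carrier unit_in_carrier]
    by (intro sum.cong refl) (use assms in auto)
  then show ?thesis using assms by simp
qed

lemma tensor_inner_coord:
  "tensor_inner d n \<rho> S T =
     (\<Sum>p\<in>U. \<Sum>q\<in>U. weight p * weight q * (cnj (S p q) * T p q))"
proof -
  have "tensor_inner d n \<rho> S T = (\<Sum>p\<in>U. \<Sum>q\<in>U. \<Sum>r\<in>U. \<Sum>s\<in>U.
      if r = p then if s = q then weight p * weight q * (cnj (S p q) * T p q) else 0 else 0)"
    by (auto simp: tensor_inner_def sum.cartesian_product[symmetric] inner_units intro!: sum.cong)
  also have "\<dots> = (\<Sum>p\<in>U. \<Sum>q\<in>U. \<Sum>r\<in>U.
      if r = p then weight p * weight q * (cnj (S p q) * T p q) else 0)"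
    by (intro sum.cong refl) simp
  finally show ?thesis by simp
qed

lemma corr_inner_in_carrier [simp]: "corr_inner d n \<rho> S T \<in> alg_carrier d n"
  by (simp add: corr_inner_def)

text \<open>Orthogonality of the matrix units removes one of the two first-leg indices, and the product
\<open>e\<^sub>k\<^sub>l\<^sup>* e\<^sub>k\<^sub>'\<^sub>l\<^sub>'\<close> in the second leg forces a common row index \<open>k\<close>.\<close>

lemma corr_inner_entry:
  assumes "b < d" "l < n b" "l' < n b"
  shows "corr_inner d n \<rho> S T b $$ (l, l') =
     (\<Sum>p\<in>U. \<Sum>k<n b. weight p * (cnj (S p (b, k, l)) * T p (b, k, l')))"
proof -
  have unit: "alg_mult d (alg_star d (alg_unit d n q)) (alg_unit d n s) b $$ (l, l') =
      (\<Sum>k<n b. if s = (b, k, l') then if q = (b, k, l) then 1 else 0 else 0)" for q s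
    unfolding mult_block_entry[where n = n and d = d, OF star_in_carrier[OF unit_in_carrier] unit_in_carrier assms]
    by (intro sum.cong refl) (simp add: star_entry[OF unit_in_carrier] unit_entry assms)
  have "corr_inner d n \<rho> S T b $$ (l, l') = (\<Sum>p\<in>U. \<Sum>q\<in>U. \<Sum>r\<in>U. \<Sum>s\<in>U.
      cnj (S p q) * T r s * alg_state d \<rho> (alg_mult d (alg_star d (alg_unit d n p)) (alg_unit d n r)) *
      alg_mult d (alg_star d (alg_unit d n q)) (alg_unit d n s) b $$ (l, l'))"
    unfolding corr_inner_def using assms
    by (subst lincomb_entry) (auto simp: sum.cartesian_product' simp del: sum.cartesian_product)
  also have "\<dots> = (\<Sum>p\<in>U. \<Sum>q\<in>U. \<Sum>r\<in>U. \<Sum>s\<in>U. \<Sum>k<n b.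
      if s = (b, k, l') then if q = (b, k, l) then if r = p
        then weight p * (cnj (S p q) * T p s) else 0 else 0 else 0)"
    unfolding unit sum_distrib_left
    by (intro sum.cong refl) (simp add: inner_units[unfolded alg_inner_def])
  also have "\<dots> = (\<Sum>p\<in>U. \<Sum>q\<in>U. \<Sum>r\<in>U. \<Sum>k<n b.
      if r = p then if q = (b, k, l) then weight p * (cnj (S p q) * T p (b, k, l')) else 0 else 0)"
    using assms by (intro sum.cong refl, subst sum.swap) (simp, intro sum.cong refl, simp)
  also have "\<dots> = (\<Sum>p\<in>U. \<Sum>q\<in>U. \<Sum>k<n b.
      if q = (b, k, l) then weight p * (cnj (S p q) * T p (b, k, l')) else 0)"
    by (intro sum.cong refl, subst sum.swap) simp
  also have "\<dots> = (\<Sum>p\<in>U. \<Sum>k<n b. weight p * (cnj (S p (b, k, l)) * T p (b, k, l')))"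
    using assms by (intro sum.cong refl, subst sum.swap) simp
  finally show ?thesis .
qed

text \<open>That is, \<open>m\<^sup>*(1) = \<Sum> e\<^sub>i\<^sub>j \<rho>\<^sup>-\<^sup>1 \<otimes> e\<^sub>j\<^sub>i\<close>. The adjoint is described by a universal property. Existence
holds because pairing this tensor with \<open>S\<close> gives \<open>\<psi>(m(S))\<close>, the weight of one leg cancelling against
\<open>\<rho>\<^sup>-\<^sup>1\<close>. Uniqueness holds because pairing with \<open>e\<^sub>p \<otimes> e\<^sub>q\<close> recovers each coordinate up to a nonzero
weight.\<close>

lemma mult_adj_one:
  "mult_adj d n \<rho> (alg_one d n) =
     (\<lambda>(a, i, j) q. if (a, i, j) \<in> U \<and> q = (a, j, i) then 1 / \<rho> a $$ (j, j) else 0)"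
    (is "_ = ?T")
  unfolding mult_adj_def
proof (rule the_equality)
  have T_carrier: "?T \<in> tensor_carrier d n"
    by (auto simp: tensor_carrier_def)
  have T_adj: "tensor_inner d n \<rho> ?T S = alg_inner d \<rho> (alg_one d n) (mult_map d n S)" for S
  proof -
    have "tensor_inner d n \<rho> ?T S = (\<Sum>a<d. \<Sum>i<n a. \<Sum>j<n a. \<Sum>q\<in>U.
        if q = (a, j, i) then \<rho> a $$ (i, i) * S (a, i, j) (a, j, i) else 0)"
      unfolding tensor_inner_coord sum_unit_indices[of _ d n, where f = "\<lambda>p. \<Sum>q\<in>U. F p q" for F]
      by (intro sum.cong refl) (auto simp: density_real density_nonzero)
    also have "\<dots> = (\<Sum>a<d. \<Sum>i<n a. \<Sum>j<n a. \<rho> a $$ (i, i) * S (a, i, j) (a, j, i))"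
      by (intro sum.cong refl) simp
    also have "\<dots> = (\<Sum>a<d. \<Sum>i<n a. \<Sum>l<n a.
        if l = i then \<Sum>j<n a. \<rho> a $$ (i, i) * S (a, i, j) (a, j, i) else 0)"
      by (rule sum.cong[OF refl], rule sum.cong[OF refl]) simp
    also have "\<dots> = alg_inner d \<rho> (alg_one d n) (mult_map d n S)"
      unfolding inner_coord[OF one_in_carrier mult_map_in_carrier] sum_unit_indices
      by (intro sum.cong refl)
         (simp add: alg_coord_def alg_one_def mult_map_entry sum_distrib_left)
    finally show ?thesis .
  qed
  then show "?T \<in> tensor_carrier d n \<and> (\<forall>S\<in>tensor_carrier d n.
      tensor_inner d n \<rho> ?T S = alg_inner d \<rho> (alg_one d n) (mult_map d n S))"
    using T_carrier by blast
  fix T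
  assume T: "T \<in> tensor_carrier d n \<and> (\<forall>S\<in>tensor_carrier d n.
      tensor_inner d n \<rho> T S = alg_inner d \<rho> (alg_one d n) (mult_map d n S))"
  show "T = ?T"
  proof (intro ext)
    fix p q
    show "T p q = ?T p q"
    proof (cases "p \<in> U \<and> q \<in> U")
      case True
      \<comment> \<open>the elementary tensor \<open>e\<^sub>p \<otimes> e\<^sub>q\<close>\<close>
      let ?S = "\<lambda>r s. if r = p then if s = q then 1 else 0 else 0 :: complex"
      have pick: "tensor_inner d n \<rho> X ?S = weight p * weight q * cnj (X p q)" for X
      proof -
        have "tensor_inner d n \<rho> X ?S = (\<Sum>r\<in>U. if r = p then \<Sum>s\<in>U. if s = q
            then weight p * weight q * cnj (X p q) else 0 else 0)"
          unfolding tensor_inner_coord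
        proof (intro sum.cong refl)
          fix r
          show "(\<Sum>s\<in>U. weight r * weight s * (cnj (X r s) * ?S r s)) =
            (if r = p then \<Sum>s\<in>U. if s = q then weight p * weight q * cnj (X p q) else 0 else 0)"
            by (cases "r = p") (simp_all add: mult_if_zero)
        qed
        then show ?thesis using True by simp
      qed
      have "?S \<in> tensor_carrier d n"
        using True by (auto simp: tensor_carrier_def)
      then have "tensor_inner d n \<rho> T ?S = tensor_inner d n \<rho> ?T ?S"
        using T T_adj by auto
      then show ?thesis
        unfolding pick using True weight_nonzero by simp
    next
      case False
      then have "T p q = 0" "?T p q = 0"
        using T T_carrier tensor_carrier_outside by blast+
      then show ?thesis by (rule trans[OF _ sym])
    qed
  qed
qed

lemma edge_indicator_entry:
  assumes "(a, i, j) \<in> U" "(b, k, l) \<in> U"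
  shows "edge_indicator d n \<rho> \<delta> A (a, i, j) (b, k, l) =
     1 / (of_real \<delta>)\<^sup>2 * (1 / \<rho> a $$ (j, j) * A (alg_unit d n (a, j, i)) b $$ (k, l))"
proof -
  let ?T = "mult_adj d n \<rho> (alg_one d n)"
  have "tensor_map d n (\<lambda>x. x) A ?T (a, i, j) (b, k, l) =
      (\<Sum>r\<in>U. \<Sum>s\<in>U. if r = (a, i, j) then ?T r s * alg_coord (A (alg_unit d n s)) (b, k, l) else 0)"
    unfolding tensor_map_apply using assms by (auto intro!: sum.cong)
  also have "\<dots> = (\<Sum>s\<in>U. \<Sum>r\<in>U. if r = (a, i, j) then ?T r s * alg_coord (A (alg_unit d n s)) (b, k, l) else 0)"
    by (rule sum.swap)
  also have "\<dots> = (\<Sum>s\<in>U. if s = (a, j, i)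
       then 1 / \<rho> a $$ (j, j) * alg_coord (A (alg_unit d n s)) (b, k, l) else 0)"
    using assms by (intro sum.cong refl) (simp add: mult_adj_one)
  also have "\<dots> = 1 / \<rho> a $$ (j, j) * A (alg_unit d n (a, j, i)) b $$ (k, l)"
    using assms by (simp add: alg_coord_def)
  finally show ?thesis
    by (simp add: edge_indicator_def tensor_scale_def)
qed

lemma density_inverse:
  assumes "a < d"
  shows "mat_inv (\<rho> a) = mat (n a) (n a) (\<lambda>(i, j). if i = j then 1 / \<rho> a $$ (i, i) else 0)"
    (is "_ = ?D")
proof -
  have entry: "(\<Sum>m<n a. \<rho> a $$ (i, m) * M $$ (m, j)) = \<rho> a $$ (i, i) * M $$ (i, j)"
    if "i < n a" for M :: "complex mat" and i j
  proof -
    have "(\<Sum>m<n a. \<rho> a $$ (i, m) * M $$ (m, j)) =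
        (\<Sum>m<n a. if m = i then \<rho> a $$ (i, i) * M $$ (i, j) else 0)"
      using assms that density_off_diagonal[of a i] by (intro sum.cong) auto
    then show ?thesis using that by simp
  qed
  have "\<rho> a * ?D = 1\<^sub>m (n a)"
  proof (rule eq_matI)
    fix i j assume "i < dim_row (1\<^sub>m (n a))" "j < dim_col (1\<^sub>m (n a))"
    then show "(\<rho> a * ?D) $$ (i, j) = 1\<^sub>m (n a) $$ (i, j)"
      using density_carrier[OF assms] density_nonzero[OF assms] entry[of i ?D j]
      by (auto simp: scalar_prod_def atLeast0LessThan)
  qed (use density_carrier[OF assms] in auto)
  then have "det (\<rho> a) \<noteq> 0"
    using det_mult[of "\<rho> a" "n a" ?D] density_carrier[OF assms] by auto
  then have "\<rho> a \<in> Units (ring_mat TYPE(complex) (n a) ())"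
    by (rule det_non_zero_imp_unit[OF density_carrier[OF assms]])
  then obtain B where B: "mat_inverse (\<rho> a) = Some B"
    using mat_inverse(1)[OF density_carrier[OF assms], where b = "()"] by (cases "mat_inverse (\<rho> a)") auto
  have inv: "\<rho> a * B = 1\<^sub>m (n a)" "B \<in> carrier_mat (n a) (n a)"
    using mat_inverse(2)[OF density_carrier[OF assms] B] by auto
  have "B = ?D"
  proof (rule eq_matI)
    fix i j assume ij: "i < dim_row ?D" "j < dim_col ?D"
    then have "\<rho> a $$ (i, i) * B $$ (i, j) = (\<rho> a * B) $$ (i, j)"
      using density_carrier[OF assms] inv(2) entry[of i B j]
      by (auto simp: scalar_prod_def atLeast0LessThan)
    then show "B $$ (i, j) = ?D $$ (i, j)"
      using ij inv density_nonzero[OF assms] by (auto simp: field_simps)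
  qed (use inv in auto)
  then show ?thesis using B by simp
qed

lemma density_inverse_carrier: "a < d \<Longrightarrow> mat_inv (\<rho> a) \<in> carrier_mat (n a) (n a)"
  by (simp add: density_inverse)

end

section \<open>Kraus operators and the edge correspondence\<close>

text \<open>The normalisation of the Kraus operators says that they are orthogonal for the inner product
\<open>Tr (\<rho>\<^sup>-\<^sup>1 V\<^sup>* W)\<close>, all with squared length \<open>\<delta>\<^sup>2\<close>.\<close>

locale kraus_family = diagonal_state +
  fixes \<delta> :: real and A :: "alg \<Rightarrow> alg"
    and R :: "nat \<Rightarrow> nat \<Rightarrow> 'r set" and V :: "nat \<Rightarrow> nat \<Rightarrow> 'r \<Rightarrow> complex mat"
  assumes \<delta>_nonzero: "\<delta> \<noteq> 0"
    and size_pos: "a < d \<Longrightarrow> 0 < n a"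
    and finite_R: "a < d \<Longrightarrow> b < d \<Longrightarrow> finite (R b a)"
    and V_carrier: "a < d \<Longrightarrow> b < d \<Longrightarrow> r \<in> R b a \<Longrightarrow> V b a r \<in> carrier_mat (n b) (n a)"
    and kraus: "a < d \<Longrightarrow> b < d \<Longrightarrow> x \<in> carrier_mat (n a) (n a) \<Longrightarrow>
      block_map d n A b a x =
        mat_sum (n b) (n b) (R b a) (\<lambda>r. V b a r * x * mat_adjoint (V b a r))"
    and V_orthogonal: "a < d \<Longrightarrow> b < d \<Longrightarrow> r \<in> R b a \<Longrightarrow> q \<in> R b a \<Longrightarrow>
      mat_trace (mat_inv (\<rho> a) * mat_adjoint (V b a r) * V b a q) =
        (if r = q then of_real (\<delta>\<^sup>2) else 0)"
begin

abbreviation K :: "(nat \<times> nat \<times> nat \<times> 'r) set" where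
  "K \<equiv> {(a, b, i, r). a < d \<and> b < d \<and> i < n a \<and> r \<in> R b a}"

abbreviation \<phi> :: "nat \<times> nat \<times> nat \<times> 'r \<Rightarrow> tensor" where
  "\<phi> \<equiv> \<lambda>(a, b, i, r). edge_basis d n \<rho> \<delta> V a b i r"

abbreviation \<epsilon> :: tensor where "\<epsilon> \<equiv> edge_indicator d n \<rho> \<delta> A"

lemma K_Sigma: "K = (SIGMA a:{..<d}. SIGMA b:{..<d}. {..<n a} \<times> R b a)"
  by auto

lemma finite_K: "finite K"
  unfolding K_Sigma by (intro finite_SigmaI) (auto intro: finite_R)

lemma sum_K: "(\<Sum>k\<in>K. f k) = (\<Sum>a<d. \<Sum>b<d. \<Sum>i<n a. \<Sum>r\<in>R b a. f (a, b, i, r))"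
proof -
  have "(\<Sum>k\<in>K. f k) = (\<Sum>a<d. \<Sum>q\<in>(SIGMA b:{..<d}. {..<n a} \<times> R b a). f (a, q))"
    unfolding K_Sigma by (subst sum.Sigma) (auto simp: split_def intro!: finite_SigmaI finite_R)
  also have "\<dots> = (\<Sum>a<d. \<Sum>b<d. \<Sum>q\<in>{..<n a} \<times> R b a. f (a, b, q))"
    by (intro sum.cong refl, subst sum.Sigma)
       (auto simp: split_def intro!: finite_SigmaI finite_R)
  finally show ?thesis by (simp add: sum.cartesian_product split_def)
qed

text \<open>The unit \<open>e\<^sub>k\<^sub>1\<close> makes \<open>V e\<^sub>k\<^sub>1\<close> a matrix whose only nonzero column is its first one, equal to the
\<open>k\<close>-th column of \<open>V\<close>. The sum over \<open>k\<close> in the definition is resolved by the column index of the first leg.\<close>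

lemma phi_entry:
  assumes "(a, b, i, r) \<in> K" "(a', i', k) \<in> U" "(b', l, m) \<in> U"
  shows "\<phi> (a, b, i, r) (a', i', k) (b', l, m) =
    (if a' = a \<and> b' = b \<and> i' = i \<and> m = 0
     then 1 / of_real \<delta> * (V b a r $$ (l, k) / \<rho> a $$ (k, k)) else 0)"
proof -
  have left: "alg_coord (alg_embed d n a (mat_unit (n a) (n a) i s * mat_inv (\<rho> a))) (a', i', k) =
      (if s = k then if a' = a \<and> i' = i then 1 / \<rho> a $$ (k, k) else 0 else 0)"
    if "s < n a" for s
  proof (cases "a' = a")
    case True
    then have bounds: "a < d" "i' < n a" "k < n a"
      using assms by auto
    have "(mat_unit (n a) (n a) i s * mat_inv (\<rho> a)) $$ (i', k) =
        (\<Sum>m<n a. if m = s then if i' = i then if s = k then 1 / \<rho> a $$ (k, k) else 0 else 0 else 0)"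
      unfolding mat_mult_entry[OF mat_unit_carrier density_inverse_carrier[OF bounds(1)] bounds(2,3)]
      using that bounds by (intro sum.cong refl) (auto simp: density_inverse mat_unit_entry)
    then show ?thesis using assms that True by (auto simp: alg_coord_def alg_embed_def)
  qed (use assms in \<open>simp add: alg_coord_def alg_embed_def\<close>)
  have right: "alg_coord (alg_embed d n b (V b a r * mat_unit (n a) (n b) s 0)) (b', l, m) =
      (if b' = b \<and> m = 0 then V b a r $$ (l, s) else 0)" if "s < n a" for s
  proof (cases "b' = b")
    case True
    then have V: "V b a r \<in> carrier_mat (n b) (n a)" and bounds: "l < n b" "m < n b"
      using V_carrier assms by auto
    have "(V b a r * mat_unit (n a) (n b) s 0) $$ (l, m) =
        (\<Sum>t<n a. if t = s then if m = 0 then V b a r $$ (l, s) else 0 else 0)"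
      unfolding mat_mult_entry[OF V mat_unit_carrier bounds]
      using bounds by (intro sum.cong refl) (simp add: mat_unit_entry)
    then show ?thesis using assms that True by (auto simp: alg_coord_def alg_embed_def)
  qed (use assms in \<open>simp add: alg_coord_def alg_embed_def\<close>)
  have "(\<Sum>s<n a. tensor_prod d n
        (alg_embed d n a (mat_unit (n a) (n a) i s * mat_inv (\<rho> a)))
        (alg_embed d n b (V b a r * mat_unit (n a) (n b) s 0)) (a', i', k) (b', l, m)) =
      (\<Sum>s<n a. if s = k then if a' = a \<and> b' = b \<and> i' = i \<and> m = 0
        then V b a r $$ (l, k) / \<rho> a $$ (k, k) else 0 else 0)"
    unfolding tensor_prod_def using assms by (intro sum.cong refl) (simp add: left right)
  then show ?thesis
    using assms by (auto simp: edge_basis_def tensor_scale_def tensor_sum_apply)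
qed

lemma phi_outside:
  "p \<notin> U \<or> q \<notin> U \<Longrightarrow> \<phi> k p q = 0"
  by (cases k) (auto simp: edge_basis_def tensor_scale_def tensor_sum_apply tensor_prod_def)

lemma V_orthogonal_entries:
  assumes "a < d" "b < d" "r \<in> R b a" "q \<in> R b a"
  shows "(\<Sum>k<n a. \<Sum>s<n b. cnj (V b a r $$ (s, k)) * V b a q $$ (s, k) / \<rho> a $$ (k, k)) =
    (if r = q then (of_real \<delta>)\<^sup>2 else 0)"
proof -
  have V: "V b a r \<in> carrier_mat (n b) (n a)" "V b a q \<in> carrier_mat (n b) (n a)"
    using V_carrier assms by auto
  note adj = mat_adjoint_carrier[OF V(1)] and inv = density_inverse_carrier[OF assms(1)]
  have row: "(mat_inv (\<rho> a) * mat_adjoint (V b a r)) $$ (k, s) =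
      cnj (V b a r $$ (s, k)) / \<rho> a $$ (k, k)" if "k < n a" "s < n b" for k s
  proof -
    have "(mat_inv (\<rho> a) * mat_adjoint (V b a r)) $$ (k, s) =
        (\<Sum>m<n a. if m = k then cnj (V b a r $$ (s, k)) / \<rho> a $$ (k, k) else 0)"
      unfolding mat_mult_entry[OF inv adj that]
      using assms that V by (intro sum.cong refl) (auto simp: density_inverse mat_adjoint_entry)
    then show ?thesis using that by simp
  qed
  have "mat_trace (mat_inv (\<rho> a) * mat_adjoint (V b a r) * V b a q) =
      (\<Sum>k<n a. \<Sum>s<n b. (mat_inv (\<rho> a) * mat_adjoint (V b a r)) $$ (k, s) * V b a q $$ (s, k))"
    unfolding mat_trace_def using inv
    by (intro sum.cong) (auto simp: mat_mult_entry[OF mult_carrier_mat[OF inv adj] V(2)])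
  also have "\<dots> = (\<Sum>k<n a. \<Sum>s<n b. cnj (V b a r $$ (s, k)) * V b a q $$ (s, k) / \<rho> a $$ (k, k))"
    by (intro sum.cong refl) (simp add: row)
  finally have trace: "mat_trace (mat_inv (\<rho> a) * mat_adjoint (V b a r) * V b a q) = \<dots>" .
  show ?thesis using V_orthogonal[OF assms] unfolding trace by simp
qed

lemma indicator_entry:
  assumes "(a, i, j) \<in> U" "(b, k, l) \<in> U"
  shows "\<epsilon> (a, i, j) (b, k, l) = 1 / (of_real \<delta>)\<^sup>2 *
    (\<Sum>r\<in>R b a. V b a r $$ (k, j) * cnj (V b a r $$ (l, i)) / \<rho> a $$ (j, j))"
proof -
  have "A (alg_unit d n (a, j, i)) b $$ (k, l) =
      (\<Sum>r\<in>R b a. V b a r $$ (k, j) * cnj (V b a r $$ (l, i)))"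
  proof -
    have summand: "(V b a r * mat_unit (n a) (n a) j i * mat_adjoint (V b a r)) $$ (k, l) =
        V b a r $$ (k, j) * cnj (V b a r $$ (l, i))" if r: "r \<in> R b a" for r
    proof -
      have V: "V b a r \<in> carrier_mat (n b) (n a)"
        using V_carrier assms r by auto
      have ij: "i < n a" "j < n a" and kl: "k < n b" "l < n b"
        using assms by auto
      have row: "(V b a r * mat_unit (n a) (n a) j i) $$ (k, s) =
          (if s = i then V b a r $$ (k, j) else 0)" if "s < n a" for s
      proof -
        have "(V b a r * mat_unit (n a) (n a) j i) $$ (k, s) =
            (\<Sum>t<n a. if t = j then if s = i then V b a r $$ (k, j) else 0 else 0)"
          unfolding mat_mult_entry[OF V mat_unit_carrier kl(1) that]
          using that by (intro sum.cong refl) (auto simp: mat_unit_entry)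
        then show ?thesis using ij by simp
      qed
      have "(V b a r * mat_unit (n a) (n a) j i * mat_adjoint (V b a r)) $$ (k, l) =
          (\<Sum>s<n a. if s = i then V b a r $$ (k, j) * cnj (V b a r $$ (l, i)) else 0)"
        unfolding mat_mult_entry[OF mult_carrier_mat[OF V mat_unit_carrier] mat_adjoint_carrier[OF V] kl]
        using kl V by (intro sum.cong refl) (auto simp: row mat_adjoint_entry)
      then show ?thesis using ij by simp
    qed
    have "A (alg_unit d n (a, j, i)) b = block_map d n A b a (mat_unit (n a) (n a) j i)"
      by (simp add: block_map_def alg_unit_def)
    also have "\<dots> = mat_sum (n b) (n b) (R b a)
        (\<lambda>r. V b a r * mat_unit (n a) (n a) j i * mat_adjoint (V b a r))"
      using assms by (intro kraus) (auto simp: mat_unit_def)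
    finally show ?thesis
      using assms by (simp add: mat_sum_def summand)
  qed
  then show ?thesis
    using assms by (simp add: edge_indicator_entry sum_divide_distrib)
qed

text \<open>The Kraus decomposition splits the entry of \<open>x \<epsilon> y\<close> into \<open>V\<^sup>r\<close>, which carries the column of the first
leg and the row of the second one, and the entry of \<open>x V\<^sup>r\<^sup>* y\<close>, which carries the other two indices.\<close>

lemma generator_entry:
  assumes "x \<in> alg_carrier d n" "y \<in> alg_carrier d n" "(a, i, j) \<in> U" "(b, k, l) \<in> U"
  shows "left_act d n x (right_act d n \<epsilon> y) (a, i, j) (b, k, l) =
    1 / (of_real \<delta>)\<^sup>2 * (\<Sum>r\<in>R b a. V b a r $$ (k, j) / \<rho> a $$ (j, j) *
      (\<Sum>m<n a. \<Sum>s<n b. x a $$ (i, m) * cnj (V b a r $$ (s, m)) * y b $$ (s, l)))"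
proof -
  have "left_act d n x (right_act d n \<epsilon> y) (a, i, j) (b, k, l) =
      (\<Sum>m<n a. \<Sum>s<n b. \<Sum>r\<in>R b a. 1 / (of_real \<delta>)\<^sup>2 * (V b a r $$ (k, j) / \<rho> a $$ (j, j) *
        (x a $$ (i, m) * cnj (V b a r $$ (s, m)) * y b $$ (s, l))))"
    using assms
    by (auto simp: left_act_apply right_act_apply indicator_entry sum_distrib_left sum_distrib_right
      mult_ac intro!: sum.cong)
  also have "\<dots> = (\<Sum>r\<in>R b a. \<Sum>m<n a. \<Sum>s<n b.
      1 / (of_real \<delta>)\<^sup>2 * (V b a r $$ (k, j) / \<rho> a $$ (j, j) *
        (x a $$ (i, m) * cnj (V b a r $$ (s, m)) * y b $$ (s, l))))"
    by (subst sum.swap[where A = "{..<n b}" and B = "R b a"],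
      subst sum.swap[where A = "{..<n a}" and B = "R b a"]) (rule refl)
  finally show ?thesis by (simp only: sum_distrib_left)
qed

text \<open>Since the second leg of each \<open>\<phi>\<close> is supported in the first column, a combination of the family
depends on its coefficients only through their first rows.\<close>

lemma combination_entry:
  assumes "\<And>k. k \<in> K \<Longrightarrow> y k \<in> alg_carrier d n" "(a, i, j) \<in> U" "(b, k, l) \<in> U"
  shows "(\<Sum>q\<in>K. right_act d n (\<phi> q) (y q)) (a, i, j) (b, k, l) =
    1 / of_real \<delta> * (\<Sum>r\<in>R b a. V b a r $$ (k, j) / \<rho> a $$ (j, j) * y (a, b, i, r) b $$ (0, l))"
proof -
  let ?c = "\<lambda>r. 1 / of_real \<delta> * (V b a r $$ (k, j) / \<rho> a $$ (j, j) * y (a, b, i, r) b $$ (0, l))"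
  have summand: "right_act d n (\<phi> (a', b', i', r)) (y (a', b', i', r)) (a, i, j) (b, k, l) =
      (if a' = a then if b' = b then if i' = i then ?c r else 0 else 0 else 0)"
    if q: "(a', b', i', r) \<in> K" for a' b' i' r
  proof -
    have "right_act d n (\<phi> (a', b', i', r)) (y (a', b', i', r)) (a, i, j) (b, k, l) =
        (\<Sum>m<n b. if m = 0 then if a' = a then if b' = b then if i' = i then ?c r
          else 0 else 0 else 0 else 0)"
      unfolding right_act_apply[OF assms(1)[OF q] assms(2,3)]
      using assms(2,3) by (intro sum.cong refl) (subst phi_entry[OF q], auto)
    then show ?thesis using assms size_pos by simp
  qed
  have "(\<Sum>q\<in>K. right_act d n (\<phi> q) (y q)) (a, i, j) (b, k, l) =
      (\<Sum>a'<d. \<Sum>b'<d. \<Sum>i'<n a'. \<Sum>r\<in>R b' a'.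
        right_act d n (\<phi> (a', b', i', r)) (y (a', b', i', r)) (a, i, j) (b, k, l))"
    unfolding tensor_sum_apply sum_K ..
  also have "\<dots> = (\<Sum>a'<d. \<Sum>b'<d. \<Sum>i'<n a'. \<Sum>r\<in>R b' a'.
      if a' = a then if b' = b then if i' = i then ?c r else 0 else 0 else 0)"
    by (intro sum.cong refl summand) auto
  also have "\<dots> = (\<Sum>r\<in>R b a. ?c r)"
    using assms(2,3) by (simp only: sum_if_const sum.delta finite_lessThan) simp
  finally show ?thesis by (simp only: sum_distrib_left)
qed

text \<open>The first leg forces equal blocks \<open>a\<close> and equal rows \<open>i\<close>, the second leg equal blocks \<open>b\<close>. What remains
is \<open>\<delta>\<^sup>-\<^sup>2 Tr (\<rho>\<^sup>-\<^sup>1 V\<^sup>r\<^sup>* V\<^sup>q)\<close> in the top left corner of block \<open>b\<close>, to which the Kraus normalisation applies.\<close>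

lemma phi_corr_inner:
  assumes "k \<in> K" "k' \<in> K"
  shows "corr_inner d n \<rho> (\<phi> k) (\<phi> k') =
    (if k = k' then alg_unit d n (fst (snd k), 0, 0) else alg_zero d n)"
proof -
  obtain a b i r where k: "k = (a, b, i, r)" by (cases k)
  obtain a' b' i' r' where k': "k' = (a', b', i', r')" by (cases k')
  have kK: "(a, b, i, r) \<in> K" and kK': "(a', b', i', r') \<in> K"
    using assms k k' by auto
  have bounds: "a < d" "b < d" "i < n a" "r \<in> R b a" "a' < d" "b' < d" "i' < n a'" "r' \<in> R b' a'"
    using kK kK' by auto
  show ?thesis
  proof (rule alg_eqI)
    fix c l l' assume c: "c < d" "l < n c" "l' < n c"
    have summand: "weight (a1, i1, j1) * (cnj (\<phi> k (a1, i1, j1) (c, s, l)) * \<phi> k' (a1, i1, j1) (c, s, l')) =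
        (if a1 = a then if i1 = i then
          (if a = a' \<and> b = b' \<and> i = i' \<and> c = b \<and> l = 0 \<and> l' = 0 then
          1 / (of_real \<delta>)\<^sup>2 * (cnj (V b a r $$ (s, j1)) * V b a r' $$ (s, j1) / \<rho> a $$ (j1, j1)) else 0)
        else 0 else 0)"
      if "a1 < d" "i1 < n a1" "j1 < n a1" "s < n c" for a1 i1 j1 s
    proof -
      have U: "(a1, i1, j1) \<in> U" "(c, s, l) \<in> U" "(c, s, l') \<in> U" using that c by auto
      have \<rho>: "\<rho> a1 $$ (j1, j1) \<noteq> 0" "cnj (\<rho> a1 $$ (j1, j1)) = \<rho> a1 $$ (j1, j1)"
        using that density_nonzero density_real by auto
      show ?thesis
      proof (cases "a1 = a \<and> i1 = i \<and> a = a' \<and> b = b' \<and> i = i' \<and> c = b \<and> l = 0 \<and> l' = 0")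
        case True
        then have eqs: "a1 = a'" "a = a'" "i1 = i'" "i = i'" "b = b'" "c = b'" "l = 0" "l' = 0"
          by auto
        show ?thesis
          unfolding k k' phi_entry[OF kK U(1,2)] phi_entry[OF kK' U(1,3)]
          unfolding eqs weight.simps
          by (simp only: weighted_product[OF \<rho>[unfolded eqs]] simp_thms if_True)
      next
        case False
        show ?thesis
          unfolding k k' phi_entry[OF kK U(1,2)] phi_entry[OF kK' U(1,3)]
            if_product nested_if
          by (subst if_not_P, use False in blast, subst if_not_P, use False in blast, rule refl)
      qed
    qed
    have "corr_inner d n \<rho> (\<phi> k) (\<phi> k') c $$ (l, l') =
        (\<Sum>a1<d. \<Sum>i1<n a1. \<Sum>j1<n a1. \<Sum>s<n c. if a1 = a then if i1 = i then
          (if a = a' \<and> b = b' \<and> i = i' \<and> c = b \<and> l = 0 \<and> l' = 0 then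
          1 / (of_real \<delta>)\<^sup>2 * (cnj (V b a r $$ (s, j1)) * V b a r' $$ (s, j1) / \<rho> a $$ (j1, j1)) else 0)
        else 0 else 0)"
      unfolding corr_inner_entry[OF c] sum_unit_indices
      by (intro sum.cong refl summand) auto
    also have "\<dots> = (if a = a' \<and> b = b' \<and> i = i' \<and> c = b \<and> l = 0 \<and> l' = 0 then
        1 / (of_real \<delta>)\<^sup>2 *
        (\<Sum>j1<n a. \<Sum>s<n b. cnj (V b a r $$ (s, j1)) * V b a r' $$ (s, j1) / \<rho> a $$ (j1, j1)) else 0)"
      using bounds by (simp only: sum_if_const sum.delta finite_lessThan) (simp add: sum_distrib_left)
    also have "\<dots> = (if k = k' \<and> c = b \<and> l = 0 \<and> l' = 0 then 1 else 0)"
      using bounds \<delta>_nonzero by (auto simp: V_orthogonal_entries k k')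
    also have "\<dots> = (if k = k' then alg_unit d n (fst (snd k), 0, 0) else alg_zero d n) c $$ (l, l')"
      using c by (auto simp: unit_entry k alg_zero_def)
    finally show "corr_inner d n \<rho> (\<phi> k) (\<phi> k') c $$ (l, l') = \<dots>" .
  qed auto
qed

text \<open>The element \<open>e\<^sub>i\<^sub>j \<epsilon> e\<^sub>s\<^sub>1\<close> is \<open>\<delta>\<^sup>-\<^sup>1\<close> times the sum of the \<open>\<phi>\<^sup>i\<^sup>t\<close> with coefficients \<open>cnj V\<^sup>t\<^sub>s\<^sub>j\<close>. Weighting it by
\<open>V\<^sup>r\<^sub>s\<^sub>j / \<rho>\<^sub>j\<close> and summing over \<open>j\<close> and \<open>s\<close> turns these coefficients into the traces
\<open>Tr (\<rho>\<^sup>-\<^sup>1 V\<^sup>t\<^sup>* V\<^sup>r)\<close>, so that only \<open>t = r\<close> survives.\<close>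

lemma phi_in_edge_corr:
  assumes "k \<in> K"
  shows "\<phi> k \<in> edge_corr d n \<rho> \<delta> A"
proof -
  obtain a b i r where k: "k = (a, b, i, r)" by (cases k)
  have kK: "(a, b, i, r) \<in> K" and bounds: "a < d" "b < d" "i < n a" "r \<in> R b a"
    using assms k by auto
  \<comment> \<open>The factor \<open>1 / \<delta>\<close> turns the \<open>\<delta>\<^sup>2\<close> of the normalisation and the \<open>\<delta>\<^sup>-\<^sup>2\<close> of \<open>\<epsilon>\<close> into the \<open>\<delta>\<^sup>-\<^sup>1\<close> of \<open>\<phi>\<close>.\<close>
  let ?g = "\<lambda>j s. left_act d n (alg_unit d n (a, i, j)) (right_act d n \<epsilon> (alg_unit d n (b, s, 0)))"
  let ?c = "\<lambda>j s. 1 / of_real \<delta> * (V b a r $$ (s, j) / \<rho> a $$ (j, j))"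
  have entry: "?g j s (a1, i1, j1) (b1, k1, l1) =
      (if a1 = a \<and> b1 = b \<and> i1 = i \<and> l1 = 0 then 1 / (of_real \<delta>)\<^sup>2 *
        (\<Sum>q\<in>R b a. V b a q $$ (k1, j1) / \<rho> a $$ (j1, j1) * cnj (V b a q $$ (s, j))) else 0)"
    if "j < n a" "s < n b" and U: "(a1, i1, j1) \<in> U" "(b1, k1, l1) \<in> U" for j s a1 i1 j1 b1 k1 l1
  proof -
    have "(\<Sum>m<n a1. \<Sum>t<n b1. alg_unit d n (a, i, j) a1 $$ (i1, m) * cnj (V b1 a1 q $$ (t, m)) *
        alg_unit d n (b, s, 0) b1 $$ (t, l1)) =
        (if a1 = a \<and> b1 = b \<and> i1 = i \<and> l1 = 0 then cnj (V b a q $$ (s, j)) else 0)" for q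
    proof (cases "a1 = a \<and> b1 = b \<and> i1 = i \<and> l1 = 0")
      case True
      then show ?thesis using that by (simp add: unit_entry mult_if_zero)
    next
      case False
      then show ?thesis using that by (auto simp: unit_entry)
    qed
    note inner_sum = this
    show ?thesis
      unfolding generator_entry[OF unit_in_carrier unit_in_carrier U] inner_sum
      by (simp only: mult_if_zero sum_if_const, rule if_cong) simp_all
  qed
  have "\<phi> k = (\<Sum>j<n a. \<Sum>s<n b. tensor_scale (?c j s) (?g j s))"
  proof (intro ext)
    fix p q
    show "\<phi> k p q = (\<Sum>j<n a. \<Sum>s<n b. tensor_scale (?c j s) (?g j s)) p q"
    proof (cases "p \<in> U \<and> q \<in> U")
      case True
      obtain a1 i1 j1 b1 k1 l1 where pq: "p = (a1, i1, j1)" "q = (b1, k1, l1)"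
        by (cases p; cases q)
      let ?w = "\<lambda>t. 1 / of_real \<delta> * (1 / (of_real \<delta>)\<^sup>2 * (V b a t $$ (k1, j1) / \<rho> a $$ (j1, j1)))"
      let ?D = "\<lambda>t j s. cnj (V b a t $$ (s, j)) * V b a r $$ (s, j) / \<rho> a $$ (j, j)"
      let ?P = "a1 = a \<and> b1 = b \<and> i1 = i \<and> l1 = 0"
      have U: "(a1, i1, j1) \<in> U" "(b1, k1, l1) \<in> U" using True pq by auto
      have "(\<Sum>j<n a. \<Sum>s<n b. tensor_scale (?c j s) (?g j s)) p q =
          (\<Sum>j<n a. \<Sum>s<n b. ?c j s * ?g j s (a1, i1, j1) (b1, k1, l1))"
        by (simp add: tensor_sum_apply tensor_scale_def pq)
      also have "\<dots> = (\<Sum>j<n a. \<Sum>s<n b. if ?P then \<Sum>t\<in>R b a. ?w t * ?D t j s else 0)"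
      proof (intro sum.cong refl)
        fix j s assume js: "j \<in> {..<n a}" "s \<in> {..<n b}"
        then have "?c j s * ?g j s (a1, i1, j1) (b1, k1, l1) =
            (if ?P then ?c j s * (1 / (of_real \<delta>)\<^sup>2 *
              (\<Sum>q\<in>R b a. V b a q $$ (k1, j1) / \<rho> a $$ (j1, j1) * cnj (V b a q $$ (s, j)))) else 0)"
          by (simp only: entry[OF _ _ U] lessThan_iff mult_if_zero)
        also have "?c j s * (1 / (of_real \<delta>)\<^sup>2 *
              (\<Sum>q\<in>R b a. V b a q $$ (k1, j1) / \<rho> a $$ (j1, j1) * cnj (V b a q $$ (s, j)))) =
            (\<Sum>t\<in>R b a. ?w t * ?D t j s)"
          unfolding sum_distrib_left by (intro sum.cong refl) (simp add: mult_ac)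
        finally show "?c j s * ?g j s (a1, i1, j1) (b1, k1, l1) =
            (if ?P then \<Sum>t\<in>R b a. ?w t * ?D t j s else 0)" .
      qed
      also have "\<dots> = (if ?P then \<Sum>t\<in>R b a. \<Sum>j<n a. \<Sum>s<n b. ?w t * ?D t j s else 0)"
        unfolding sum_if_const
        by (subst sum.swap[where A = "{..<n b}" and B = "R b a"],
          subst sum.swap[where A = "{..<n a}" and B = "R b a"]) (rule refl)
      also have "\<dots> = (if ?P then \<Sum>t\<in>R b a. ?w t * (\<Sum>j<n a. \<Sum>s<n b. ?D t j s) else 0)"
        by (simp only: sum_distrib_left)
      also have "(\<Sum>t\<in>R b a. ?w t * (\<Sum>j<n a. \<Sum>s<n b. ?D t j s)) =
          (\<Sum>t\<in>R b a. if t = r then 1 / of_real \<delta> * (V b a r $$ (k1, j1) / \<rho> a $$ (j1, j1)) else 0)"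
        using bounds \<delta>_nonzero by (intro sum.cong refl) (simp add: V_orthogonal_entries)
      also have "(if ?P then \<Sum>t\<in>R b a. if t = r
          then 1 / of_real \<delta> * (V b a r $$ (k1, j1) / \<rho> a $$ (j1, j1)) else 0 else 0) = \<phi> k p q"
        unfolding k pq phi_entry[OF kK U]
        by (rule if_cong[OF refl _ refl]) (simp add: bounds finite_R)
      finally show ?thesis ..
    next
      case False
      then have "\<phi> k p q = 0" by (rule phi_outside[OF iffD1[OF de_Morgan_conj]])
      then show ?thesis
        using False by (simp add: tensor_sum_apply tensor_scale_def act_outside)
    qed
  qed
  moreover have "?g j s \<in> edge_corr d n \<rho> \<delta> A" for j s
    by (rule generator_in_edge_corr[OF unit_in_carrier unit_in_carrier])
  ultimately show ?thesis
    unfolding edge_corr_def by (simp only:) (intro tensor.span_sum tensor.span_scale)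
qed

text \<open>The coefficient of \<open>\<phi>\<^sup>i\<^sup>r\<close> is read off by comparing the entries of \<open>x \<epsilon> y\<close> with those of a general
combination: its first row has to be the \<open>i\<close>-th row of \<open>x V\<^sup>r\<^sup>* y\<close>, divided by \<open>\<delta>\<close>.\<close>

lemma generator_in_right_span:
  assumes "x \<in> alg_carrier d n" "y \<in> alg_carrier d n"
  shows "left_act d n x (right_act d n \<epsilon> y) \<in> right_module_span d n K \<phi>"
proof -
  define z where "z = (\<lambda>(a, b, i, r). alg_embed d n b (mat (n b) (n b) (\<lambda>(k, l).
    1 / of_real \<delta> * (\<Sum>m<n a. \<Sum>s<n b. x a $$ (i, m) * cnj (V b a r $$ (s, m)) * y b $$ (s, l)))))"
  have z: "z k \<in> alg_carrier d n" for k
    by (cases k) (auto simp: z_def alg_carrier_def alg_embed_def)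
  have "left_act d n x (right_act d n \<epsilon> y) = (\<Sum>k\<in>K. right_act d n (\<phi> k) (z k))"
  proof (intro ext)
    fix p q
    show "left_act d n x (right_act d n \<epsilon> y) p q = (\<Sum>k\<in>K. right_act d n (\<phi> k) (z k)) p q"
    proof (cases "p \<in> U \<and> q \<in> U")
      case True
      obtain a i j b k l where pq: "p = (a, i, j)" "q = (b, k, l)"
        by (cases p; cases q)
      have U: "(a, i, j) \<in> U" "(b, k, l) \<in> U" using True pq by auto
      \<comment> \<open>row \<open>0\<close> exists because the blocks are nonempty\<close>
      then have "0 < n b" using size_pos by auto
      then have "z (a, b, i, r) b $$ (0, l) =
          1 / of_real \<delta> * (\<Sum>m<n a. \<Sum>s<n b. x a $$ (i, m) * cnj (V b a r $$ (s, m)) * y b $$ (s, l))" for r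
        using U by (simp add: z_def alg_embed_def)
      then show ?thesis
        unfolding pq generator_entry[OF assms U] combination_entry[OF z U]
        by (simp add: sum_distrib_left power2_eq_square mult_ac)
    next
      case False
      then show ?thesis by (simp add: tensor_sum_apply act_outside)
    qed
  qed
  then show ?thesis
    unfolding mem_right_module_span[OF finite_K] using z by (intro exI[of _ z] conjI ballI)
qed

lemma orthonormal_basis:
  "module_orthonormal_basis d n \<rho> (edge_corr d n \<rho> \<delta> A) K \<phi>"
  unfolding module_orthonormal_basis_def
proof (intro conjI ballI impI)
  show "\<phi> k \<in> edge_corr d n \<rho> \<delta> A" if "k \<in> K" for k
    using that by (rule phi_in_edge_corr)
  show "corr_inner d n \<rho> (\<phi> k) (\<phi> l) = alg_zero d n" if "k \<in> K" "l \<in> K" "k \<noteq> l" for k l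
    using phi_corr_inner[OF that(1,2)] that(3) by simp
  show "alg_projection d n (corr_inner d n \<rho> (\<phi> k) (\<phi> k))" if "k \<in> K" for k
  proof -
    have "fst (snd k) < d" using that by auto
    then show ?thesis
      unfolding phi_corr_inner[OF that that] using size_pos
      by (simp add: projection_diagonal_unit)
  qed
  show "right_module_span d n K \<phi> = edge_corr d n \<rho> \<delta> A"
  proof
    show "right_module_span d n K \<phi> \<subseteq> edge_corr d n \<rho> \<delta> A"
    proof
      fix T assume "T \<in> right_module_span d n K \<phi>"
      then obtain y
        where T: "T = (\<Sum>k\<in>K. right_act d n (\<phi> k) (y k))" and y: "\<forall>k\<in>K. y k \<in> alg_carrier d n"
        unfolding mem_right_module_span[OF finite_K] by (elim exE conjE)
      have "right_act d n (\<phi> k) (y k) \<in> edge_corr d n \<rho> \<delta> A" if "k \<in> K" for k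
        by (rule right_act_edge_corr[OF phi_in_edge_corr[OF that] bspec[OF y that]])
      then show "T \<in> edge_corr d n \<rho> \<delta> A"
        unfolding T edge_corr_def by (rule tensor.span_sum)
    qed
    show "edge_corr d n \<rho> \<delta> A \<subseteq> right_module_span d n K \<phi>"
      unfolding edge_corr_def
      by (rule tensor.span_minimal[OF _ subspace_right_module_span[OF finite_K]])
         (clarify, rule generator_in_right_span)
  qed
qed

end

section \<open>The orthonormal basis\<close>

theorem theorem2:
  fixes d :: nat and n :: "nat \<Rightarrow> nat" and \<rho> :: "nat \<Rightarrow> complex mat" and \<delta> :: real
    and A :: "alg \<Rightarrow> alg"
    and R :: "nat \<Rightarrow> nat \<Rightarrow> 'r set" and V :: "nat \<Rightarrow> nat \<Rightarrow> 'r \<Rightarrow> complex mat"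
  assumes "quantum_graph d n \<rho> \<delta> A"
    and "\<And>a. a < d \<Longrightarrow> diagonal_mat (\<rho> a)"
    and "\<And>a b. a < d \<Longrightarrow> b < d \<Longrightarrow> finite (R b a)"
    and "\<And>a b r. a < d \<Longrightarrow> b < d \<Longrightarrow> r \<in> R b a \<Longrightarrow> V b a r \<in> carrier_mat (n b) (n a)"
    and "\<And>a b x. a < d \<Longrightarrow> b < d \<Longrightarrow> x \<in> carrier_mat (n a) (n a) \<Longrightarrow>
           block_map d n A b a x =
             mat_sum (n b) (n b) (R b a) (\<lambda>r. V b a r * x * mat_adjoint (V b a r))"
    and "\<And>a b r q. a < d \<Longrightarrow> b < d \<Longrightarrow> r \<in> R b a \<Longrightarrow> q \<in> R b a \<Longrightarrow>
           mat_trace (mat_inv (\<rho> a) * mat_adjoint (V b a r) * V b a q) =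
             (if r = q then of_real (\<delta>\<^sup>2) else 0)"
  shows "module_orthonormal_basis d n \<rho> (edge_corr d n \<rho> \<delta> A)
           {(a, b, i, r). a < d \<and> b < d \<and> i < n a \<and> r \<in> R b a}
           (\<lambda>(a, b, i, r). edge_basis d n \<rho> \<delta> V a b i r)"
proof -
  have graph: "\<forall>a<d. 0 < n a" "0 < \<delta>" "state_density d n \<rho>"
    using assms(1) by (auto simp: quantum_graph_def delta_form_def)
  have carrier: "\<rho> a \<in> carrier_mat (n a) (n a)" if "a < d" for a
    using graph(3) that by (auto simp: state_density_def pos_mat_def)
  have diagonal: "\<rho> a $$ (i, j) = 0" if "a < d" "i < n a" "j < n a" "i \<noteq> j" for a i j
    using assms(2)[OF that(1)] carrier[OF that(1)] that by (auto simp: diagonal_mat_def)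
  have invertible: "invertible_mat (\<rho> a)" and positive: "pos_mat (n a) (\<rho> a)" if "a < d" for a
    using graph(3) that by (auto simp: state_density_def)
  interpret kraus_family d n \<rho> \<delta> A R V
  proof
    fix a i assume a: "a < d" and i: "i < n a"
    show "\<rho> a $$ (i, i) \<noteq> 0"
      by (rule diagonal_entry_nonzero[OF carrier[OF a] invertible[OF a] _ i])
         (use diagonal a i in auto)
    show "cnj (\<rho> a $$ (i, i)) = \<rho> a $$ (i, i)"
      using positive[OF a] i by (rule pos_mat_diagonal_real)
  qed (use graph carrier diagonal assms(3-6) in auto)
  show ?thesis by (rule orthonormal_basis)
qed

end
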